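(* Let $K$ be a countably infinite field, $p(x)\in K[x]$ a non-constant polynomial which is admissible for $K$, and $(F_N)_{N\in\mathbb{N}}$ a double F\o lner sequence in $K$. Let $(X,\mathcal{X},\mu)$ be a probability space on which the affine group $\mathcal{A}_K$ acts by measure preserving transformations $(T_g)_{g\in\mathcal{A}_K}$. Then for any $f\in L^2(X,\mu)$, $$\lim_{N\to\infty}\frac{1}{|F_N|}\sum_{u\in F_N\setminus\{0\}}M_uA_{-p(u)}f=Pf,$$ where the limit is in $L^2(X,\mu)$ and $P:L^2(X,\mu)\to L^2(X,\mu)$ is the orthogonal projection onto the subspace of $\mathcal{A}_K$-invariant functions.
   Context: $\mathcal{A}_K=\{x\mapsto ux+v:\ u,v\in K,\ u\ne0\}$ is the affine group of $K$ under composition; $A_u$ denotes the map $x\mapsto x+u$ ($u\in K$) and $M_u$ the map $x\mapsto ux$ ($u\in K^*=K\setminus\{0\}$). That $(T_g)_{g\in\mathcal{A}_K}$ acts by measure preserving transformations means $T_g\circ T_h=T_{g\circ h}$ and $\mu(T_g^{-1}A)=\mu(A)$ for all $g,h\in\mathcal{A}_K$, $A\in\mathcal{X}$. The Koopman representation on $L^2(X,\mu)$ is $(U_gf)(x)=f(T_g^{-1}x)$; by abuse of notation $A_uf:=U_{A_u}f$ and $M_uf:=U_{M_u}f$. A function $f$ is $\mathcal{A}_K$-invariant if $U_gf=f$ for all $g\in\mathcal{A}_K$. A double F\o lner sequence in $K$ is a sequence $(F_N)_{N\in\mathbb{N}}$ of non-empty finite subsets of $K$ such that for every $x\in K^*$,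 $\lim_{N\to\infty}\frac{|F_N\cap(x+F_N)|}{|F_N|}=\lim_{N\to\infty}\frac{|F_N\cap(xF_N)|}{|F_N|}=1$. A non-constant $p(x)\in K[x]$ is admissible for $K$ if either $\operatorname{char}(K)=0$, or $\operatorname{char}(K)=q$ is prime and $\deg(p(x))\le q-1$. *)

theory Defs
  imports
    "HOL-Probability.Probability"
    "HOL-Computational_Algebra.Computational_Algebra"
    "HOL-Algebra.Group_Action"
begin

definition affine_group :: "('k::field \<Rightarrow> 'k) monoid" where
  "affine_group = \<lparr>carrier = {(\<lambda>x. u * x + v) | u v. u \<noteq> 0}, mult = (\<circ>), one = id\<rparr>"

definition translation :: "'k::field \<Rightarrow> 'k \<Rightarrow> 'k" where
  "translation u = (\<lambda>x. x + u)"

definition dilation :: "'k::field \<Rightarrow> 'k \<Rightarrow> 'k" where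
  "dilation u = (\<lambda>x. u * x)"

lemma group_affine_group: "group (affine_group :: ('k::field \<Rightarrow> 'k) monoid)"
proof (rule groupI)
  fix g h :: "'k \<Rightarrow> 'k"
  assume "g \<in> carrier affine_group" "h \<in> carrier affine_group"
  then obtain a b c d where *: "g = (\<lambda>x. a * x + b)" "h = (\<lambda>x. c * x + d)" "a \<noteq> 0" "c \<noteq> 0"
    by (auto simp: affine_group_def)
  then have "g \<circ> h = (\<lambda>x. (a * c) * x + (a * d + b))" "a * c \<noteq> 0"
    by (auto simp: algebra_simps)
  then show "g \<otimes>\<^bsub>affine_group\<^esub> h \<in> carrier affine_group"
    unfolding affine_group_def monoid.simps partial_object.simps by blast
next
  have "id = (\<lambda>x::'k. 1 * x + 0)" "(1::'k) \<noteq> 0"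
    by auto
  then show "\<one>\<^bsub>affine_group\<^esub> \<in> carrier (affine_group :: ('k \<Rightarrow> 'k) monoid)"
    unfolding affine_group_def monoid.simps partial_object.simps by blast
next
  fix g :: "'k \<Rightarrow> 'k"
  assume "g \<in> carrier affine_group"
  then obtain a b where *: "g = (\<lambda>x. a * x + b)" "a \<noteq> 0"
    by (auto simp: affine_group_def)
  let ?h = "\<lambda>x. inverse a * x + (- (inverse a * b))"
  have "?h \<circ> g = id" "inverse a \<noteq> 0"
    using * by (auto simp: field_simps)
  then show "\<exists>h \<in> carrier affine_group. h \<otimes>\<^bsub>affine_group\<^esub> g = \<one>\<^bsub>affine_group\<^esub>"
    unfolding affine_group_def monoid.simps partial_object.simps by blast
qed (auto simp: affine_group_def o_assoc)

lemma translation_in_affine_group: "translation u \<in> carrier affine_group"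
proof -
  have "translation u = (\<lambda>x. 1 * x + u)" "(1::'a) \<noteq> 0"
    by (auto simp: translation_def)
  then show ?thesis
    unfolding affine_group_def partial_object.simps by blast
qed

lemma dilation_in_affine_group:
  assumes "u \<noteq> 0"
  shows "dilation u \<in> carrier affine_group"
proof -
  have "dilation u = (\<lambda>x. u * x + 0)"
    by (auto simp: dilation_def)
  then show ?thesis
    using assms unfolding affine_group_def partial_object.simps by blast
qed

text \<open>The locale \<^locale>\<open>group_action\<close> represents the maps \<^term>\<open>T g\<close> as bijections of
  \<^term>\<open>space M\<close> that are \<^const>\<open>undefined\<close> outside of \<^term>\<open>space M\<close>.\<close>

definition measure_preserving_affine_action ::
    "'a measure \<Rightarrow> (('k::field \<Rightarrow> 'k) \<Rightarrow> 'a \<Rightarrow> 'a) \<Rightarrow> bool" where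
  "measure_preserving_affine_action M T \<longleftrightarrow>
     group_action affine_group (space M) T \<and>
     (\<forall>g \<in> carrier affine_group. T g \<in> measurable M M \<and>
        (\<forall>A \<in> sets M. emeasure M (T g -` A \<inter> space M) = emeasure M A))"

text \<open>Elements of the Hilbert space are represented by functions; two of them are identified when
  they agree almost everywhere.\<close>

definition L2 :: "'a measure \<Rightarrow> ('a \<Rightarrow> complex) set" where
  "L2 M = {f \<in> borel_measurable M. integrable M (\<lambda>x. (cmod (f x))\<^sup>2)}"

definition L2_inner :: "'a measure \<Rightarrow> ('a \<Rightarrow> complex) \<Rightarrow> ('a \<Rightarrow> complex) \<Rightarrow> complex" where
  "L2_inner M f g = (LINT x|M. f x * cnj (g x))"

definition L2_norm :: "'a measure \<Rightarrow> ('a \<Rightarrow> complex) \<Rightarrow> real" where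
  "L2_norm M f = sqrt (LINT x|M. (cmod (f x))\<^sup>2)"

definition L2_tendsto :: "'a measure \<Rightarrow> (nat \<Rightarrow> 'a \<Rightarrow> complex) \<Rightarrow> ('a \<Rightarrow> complex) \<Rightarrow> bool" where
  "L2_tendsto M s g \<longleftrightarrow>
     (\<forall>N. s N \<in> L2 M) \<and> g \<in> L2 M \<and> (\<lambda>N. L2_norm M (\<lambda>x. s N x - g x)) \<longlonglongrightarrow> 0"

definition koopman ::
    "'a measure \<Rightarrow> ('g \<Rightarrow> 'a \<Rightarrow> 'a) \<Rightarrow> 'g \<Rightarrow> ('a \<Rightarrow> complex) \<Rightarrow> 'a \<Rightarrow> complex" where
  "koopman M T g f = (\<lambda>x. f (inv_into (space M) (T g) x))"

definition affine_invariant ::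
    "'a measure \<Rightarrow> (('k::field \<Rightarrow> 'k) \<Rightarrow> 'a \<Rightarrow> 'a) \<Rightarrow> ('a \<Rightarrow> complex) set" where
  "affine_invariant M T =
     {f \<in> L2 M. \<forall>g \<in> carrier affine_group. AE x in M. koopman M T g f x = f x}"

text \<open>The choice below only selects a representative: any two functions with the defining property
  agree almost everywhere when \<^term>\<open>S\<close> is a subspace of \<^term>\<open>L2 M\<close>. Existence holds for closed
  subspaces, such as \<^term>\<open>affine_invariant M T\<close>.\<close>

definition orthogonal_projection ::
    "'a measure \<Rightarrow> ('a \<Rightarrow> complex) set \<Rightarrow> ('a \<Rightarrow> complex) \<Rightarrow> 'a \<Rightarrow> complex" where
  "orthogonal_projection M S f =
     (SOME g. g \<in> S \<and> (\<forall>h \<in> S. L2_inner M (\<lambda>x. f x - g x) h = 0))"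

definition double_folner :: "(nat \<Rightarrow> 'k::field set) \<Rightarrow> bool" where
  "double_folner F \<longleftrightarrow>
     (\<forall>N. finite (F N) \<and> F N \<noteq> {}) \<and>
     (\<forall>x. x \<noteq> 0 \<longrightarrow>
        (\<lambda>N. real (card (F N \<inter> (\<lambda>y. x + y) ` F N)) / real (card (F N))) \<longlonglongrightarrow> 1 \<and>
        (\<lambda>N. real (card (F N \<inter> (\<lambda>y. x * y) ` F N)) / real (card (F N))) \<longlonglongrightarrow> 1)"

definition admissible :: "'k::field poly \<Rightarrow> bool" where
  "admissible p \<longleftrightarrow> degree p > 0 \<and>
     (CHAR('k) = 0 \<or> (prime CHAR('k) \<and> degree p \<le> CHAR('k) - 1))"

end

theory Submission
  imports Defs "HOL-Library.Function_Algebras"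
begin


text \<open>
  Write \<open>A v\<close> for the unitary operator of the translation by \<open>v\<close> and \<open>D u\<close> for that of the
  dilation by \<open>u\<close>, so that the claim concerns the averages of \<open>D u (A (- p(u)) f)\<close> over a set
  that is almost invariant under translations and under dilations.

  The function \<open>f\<close> is split as \<open>(f - a) + a\<close>, where \<open>a\<close> is translation invariant and is
  approximated by convex combinations of the translates of \<open>f\<close> (lemma \<open>mean_ergodic\<close>). On \<open>a\<close> the
  translations disappear and the averages of \<open>D u a\<close> converge to the dilation invariant vector \<open>m\<close>
  that the mean ergodic theorem attaches to the dilation orbit of \<open>a\<close>. Translations are normalised
  by dilations, so the whole orbit of \<open>a\<close>, and with it \<open>m\<close>, consists of translation invariant
  vectors. Since \<open>m\<close> is reached from \<open>f\<close> by convex combinations of unitary images and limits,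
  \<open>f\<close> and \<open>m\<close> have the same inner product with every invariant function: \<open>m\<close> is the projection of
  \<open>f\<close>.

  It remains to show that the averages of \<open>D u (A (- p(u)) g)\<close> tend to zero for \<open>g = f - a\<close>, that is,
  when \<open>0\<close> lies in the closed convex hull of the translates of \<open>g\<close>. Two uses of van der
  Corput's trick (lemma \<open>van_der_Corput\<close>) do this.

  With respect to dilations (lemma \<open>avg_D_A_poly\<close>) it compares the terms at \<open>b u\<close> and \<open>c u\<close>. In
  their inner product the common factor \<open>D u\<close> cancels, which leaves
  \<open>\<langle>A (r(u)) (D b g), D c g\<rangle>\<close> with \<open>r(u) = c p(c u) - b p(b u)\<close>. This polynomial has the degree \<open>d\<close>
  of \<open>p\<close> as soon as \<open>b\<^sup>d\<^sup>+\<^sup>1\<close> and \<open>c\<^sup>d\<^sup>+\<^sup>1\<close> differ, and an infinite field has an infinite subset on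
  which \<open>b \<mapsto> b\<^sup>d\<^sup>+\<^sup>1\<close> is injective. Everything is thereby reduced to averages of \<open>A (r(u))\<close>.

  With respect to translations (lemma \<open>avg_A_poly\<close>) it replaces an admissible \<open>q\<close> by the
  differences \<open>q(u + b) - q(u + c)\<close>. Admissibility makes the degree drop by exactly one, because the
  degree of \<open>q\<close> is not zero in the field, and an induction ends with the linear polynomials. For
  these the almost invariance makes it possible to replace \<open>g\<close> by any convex combination of its translates,
  hence by vectors of arbitrarily small norm.

  All this takes place in an abstract representation of the affine group. The functions in
  \<^term>\<open>L2 M\<close> that vanish outside of \<^term>\<open>space M\<close> carry such a representation. They are not
  identified when they agree almost everywhere, which is why inner products are only required to be
  semidefinite and statements on equality of vectors take the form \<open>nrm (x - y) = 0\<close>.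
\<close>

section \<open>Averages in semi-inner product spaces\<close>

lemma null_sequence_le:
  fixes f g :: "nat \<Rightarrow> real"
  assumes "\<And>n. 0 \<le> f n" "\<And>n. f n \<le> g n" "g \<longlonglongrightarrow> 0"
  shows "f \<longlonglongrightarrow> 0"
  by (rule tendsto_sandwich[OF _ _ tendsto_const assms(3)]) (simp_all add: assms)

definition avg :: "'k set \<Rightarrow> ('k \<Rightarrow> 'v::real_vector) \<Rightarrow> 'v" where
  "avg S \<phi> = (1 / real (card S)) *\<^sub>R (\<Sum>u\<in>S. \<phi> u)"

lemma avg_add: "avg S (\<lambda>u. \<phi> u + \<psi> u) = avg S \<phi> + avg S \<psi>"
  by (simp add: avg_def sum.distrib scaleR_add_right)

lemma avg_diff: "avg S (\<lambda>u. \<phi> u - \<psi> u) = avg S \<phi> - avg S \<psi>"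
  by (simp add: avg_def sum_subtractf scaleR_diff_right)

lemma avg_scaleR: "avg S (\<lambda>u. r *\<^sub>R \<phi> u) = r *\<^sub>R avg S \<phi>"
  by (simp add: avg_def scaleR_sum_right mult.commute)

lemma avg_sum: "avg S (\<lambda>u. \<Sum>b\<in>B. \<phi> b u) = (\<Sum>b\<in>B. avg S (\<phi> b))"
  unfolding avg_def by (subst sum.swap) (simp add: scaleR_sum_right)

lemma avg_mono:
  fixes \<phi> \<psi> :: "'k \<Rightarrow> real"
  assumes "\<And>u. u \<in> S \<Longrightarrow> \<phi> u \<le> \<psi> u"
  shows "avg S \<phi> \<le> avg S \<psi>"
  using assms by (auto simp: avg_def intro!: divide_right_mono sum_mono)

lemma avg_const:
  assumes "finite S" "S \<noteq> {}"
  shows "avg S (\<lambda>_. c) = c"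
  using assms by (simp add: avg_def sum_constant_scaleR)

text \<open>
  The inner product is real and only positive semidefinite, and the vectors form a subspace of the
  ambient type: square-integrable functions fit this description without passing to classes modulo
  null sets, and convex hulls of sets of functions are available as they are.
\<close>
locale semi_inner_space =
  fixes V :: "'v::real_vector set" and ip :: "'v \<Rightarrow> 'v \<Rightarrow> real"
  assumes subspace_V: "subspace V"
    and ip_commute: "\<And>x y. x \<in> V \<Longrightarrow> y \<in> V \<Longrightarrow> ip x y = ip y x"
    and ip_add_left: "\<And>x y z. x \<in> V \<Longrightarrow> y \<in> V \<Longrightarrow> z \<in> V \<Longrightarrow> ip (x + y) z = ip x z + ip y z"
    and ip_scaleR_left: "\<And>r x y. x \<in> V \<Longrightarrow> y \<in> V \<Longrightarrow> ip (r *\<^sub>R x) y = r * ip x y"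
    and ip_nonneg: "\<And>x. x \<in> V \<Longrightarrow> 0 \<le> ip x x"
begin

definition nrm :: "'v \<Rightarrow> real" where
  "nrm x = sqrt (ip x x)"

lemma V_closed [simp, intro]:
  shows "0 \<in> V"
    and "x \<in> V \<Longrightarrow> y \<in> V \<Longrightarrow> x + y \<in> V"
    and "x \<in> V \<Longrightarrow> y \<in> V \<Longrightarrow> x - y \<in> V"
    and "x \<in> V \<Longrightarrow> r *\<^sub>R x \<in> V"
    and "x \<in> V \<Longrightarrow> - x \<in> V"
  using subspace_V by (auto simp: subspace_0 subspace_add subspace_diff subspace_scale subspace_neg)

lemma sum_in_V [simp, intro]: "(\<And>b. b \<in> B \<Longrightarrow> \<phi> b \<in> V) \<Longrightarrow> sum \<phi> B \<in> V"
  using subspace_sum[OF subspace_V] by blast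

lemma avg_in_V [simp, intro]: "(\<And>u. u \<in> S \<Longrightarrow> \<phi> u \<in> V) \<Longrightarrow> avg S \<phi> \<in> V"
  by (auto simp: avg_def)

lemma convex_hull_in_V:
  assumes "S \<subseteq> V" "x \<in> convex hull S"
  shows "x \<in> V"
  using hull_minimal[of S V convex] assms subspace_imp_convex[OF subspace_V] by blast

lemma ip_add_right: "x \<in> V \<Longrightarrow> y \<in> V \<Longrightarrow> z \<in> V \<Longrightarrow> ip x (y + z) = ip x y + ip x z"
  using ip_add_left ip_commute by (metis V_closed(2))

lemma ip_scaleR_right: "x \<in> V \<Longrightarrow> y \<in> V \<Longrightarrow> ip x (r *\<^sub>R y) = r * ip x y"
  using ip_scaleR_left ip_commute by (metis V_closed(4))

lemma ip_minus_left: "x \<in> V \<Longrightarrow> y \<in> V \<Longrightarrow> ip (- x) y = - ip x y"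
  using ip_scaleR_left[of x y "-1"] by simp

lemma ip_minus_right: "x \<in> V \<Longrightarrow> y \<in> V \<Longrightarrow> ip x (- y) = - ip x y"
  using ip_scaleR_right[of x y "-1"] by simp

lemma ip_diff_left: "x \<in> V \<Longrightarrow> y \<in> V \<Longrightarrow> z \<in> V \<Longrightarrow> ip (x - y) z = ip x z - ip y z"
  using ip_add_left[of x "-y" z] by (simp add: ip_minus_left)

lemma ip_diff_right: "x \<in> V \<Longrightarrow> y \<in> V \<Longrightarrow> z \<in> V \<Longrightarrow> ip x (y - z) = ip x y - ip x z"
  using ip_add_right[of x y "-z"] by (simp add: ip_minus_right)

lemma ip_zero_left: "x \<in> V \<Longrightarrow> ip 0 x = 0"
  using ip_scaleR_left[of x x 0] by simp

lemmas ip_simps = ip_add_left ip_add_right ip_scaleR_left ip_scaleR_right ip_minus_left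
  ip_minus_right ip_diff_left ip_diff_right

lemma ip_sum_left:
  assumes "\<And>b. b \<in> B \<Longrightarrow> \<phi> b \<in> V" "y \<in> V"
  shows "ip (sum \<phi> B) y = (\<Sum>b\<in>B. ip (\<phi> b) y)"
  using assms by (induction B rule: infinite_finite_induct) (simp_all add: ip_zero_left ip_add_left)

lemma ip_sum_right:
  assumes "\<And>b. b \<in> B \<Longrightarrow> \<phi> b \<in> V" "y \<in> V"
  shows "ip y (sum \<phi> B) = (\<Sum>b\<in>B. ip y (\<phi> b))"
proof -
  have "ip y (sum \<phi> B) = ip (sum \<phi> B) y"
    using assms by (intro ip_commute) auto
  also have "\<dots> = (\<Sum>b\<in>B. ip (\<phi> b) y)"
    using assms by (rule ip_sum_left)
  also have "\<dots> = (\<Sum>b\<in>B. ip y (\<phi> b))"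
    using assms by (intro sum.cong ip_commute) auto
  finally show ?thesis .
qed

lemma ip_avg_left:
  assumes "\<And>u. u \<in> S \<Longrightarrow> \<phi> u \<in> V" "y \<in> V"
  shows "ip (avg S \<phi>) y = avg S (\<lambda>u. ip (\<phi> u) y)"
  using assms by (simp add: avg_def ip_scaleR_left sum_in_V ip_sum_left)

lemma nrm_nonneg: "x \<in> V \<Longrightarrow> 0 \<le> nrm x"
  by (simp add: nrm_def ip_nonneg)

lemma nrm_sq: "x \<in> V \<Longrightarrow> (nrm x)\<^sup>2 = ip x x"
  by (simp add: nrm_def ip_nonneg)

lemma nrm_zero: "nrm 0 = 0"
  by (simp add: nrm_def ip_zero_left)

lemma nrm_scaleR: "x \<in> V \<Longrightarrow> nrm (r *\<^sub>R x) = \<bar>r\<bar> * nrm x"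
  by (simp add: nrm_def ip_simps real_sqrt_mult flip: mult.assoc power2_eq_square)

lemma nrm_uminus: "x \<in> V \<Longrightarrow> nrm (- x) = nrm x"
  using nrm_scaleR[of x "-1"] by simp

lemma nrm_minus_commute: "x \<in> V \<Longrightarrow> y \<in> V \<Longrightarrow> nrm (x - y) = nrm (y - x)"
  using nrm_uminus[of "x - y"] by simp

lemma Cauchy_Schwarz:
  assumes "x \<in> V" "y \<in> V"
  shows "\<bar>ip x y\<bar> \<le> nrm x * nrm y"
proof -
  let ?a = "ip x x" and ?b = "ip x y" and ?c = "ip y y"
  \<comment> \<open>The nonnegative quadratic polynomial in \<open>t\<close> may have leading coefficient zero.\<close>
  have quad: "0 \<le> ?a + 2 * t * ?b + t\<^sup>2 * ?c" for t
  proof -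
    have "0 \<le> ip (x + t *\<^sub>R y) (x + t *\<^sub>R y)"
      using assms by (intro ip_nonneg) auto
    also have "\<dots> = ?a + 2 * t * ?b + t\<^sup>2 * ?c"
      using assms by (simp add: ip_simps V_closed ip_commute[of y x] power2_eq_square algebra_simps)
    finally show ?thesis .
  qed
  have "?b\<^sup>2 \<le> ?a * ?c"
  proof (cases "?c = 0")
    case True
    have "?b = 0"
    proof (rule ccontr)
      assume "?b \<noteq> 0"
      then show False
        using quad[of "- (?a + 1) / (2 * ?b)"] True by (simp add: field_simps)
    qed
    then show ?thesis using True by simp
  next
    case False
    then have "?c > 0"
      using ip_nonneg[OF assms(2)] by simp
    then show ?thesis
      using quad[of "- ?b / ?c"] by (simp add: field_simps power2_eq_square)
  qed
  then have "sqrt (?b\<^sup>2) \<le> sqrt (?a * ?c)"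
    by (rule real_sqrt_le_mono)
  then show ?thesis
    by (simp add: nrm_def real_sqrt_mult)
qed

lemma nrm_triangle:
  assumes "x \<in> V" "y \<in> V"
  shows "nrm (x + y) \<le> nrm x + nrm y"
proof (rule power2_le_imp_le)
  have "(nrm (x + y))\<^sup>2 = ip x x + 2 * ip x y + ip y y"
    using assms by (simp add: nrm_sq ip_simps ip_commute[of y x])
  also have "\<dots> \<le> (nrm x)\<^sup>2 + 2 * (nrm x * nrm y) + (nrm y)\<^sup>2"
    using Cauchy_Schwarz[OF assms] assms by (simp add: nrm_sq)
  also have "\<dots> = (nrm x + nrm y)\<^sup>2"
    by (simp add: power2_eq_square algebra_simps)
  finally show "(nrm (x + y))\<^sup>2 \<le> (nrm x + nrm y)\<^sup>2" .
qed (use assms in \<open>auto intro!: add_nonneg_nonneg nrm_nonneg\<close>)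

lemma nrm_triangle_diff:
  assumes "x \<in> V" "y \<in> V" "z \<in> V"
  shows "nrm (x - z) \<le> nrm (x - y) + nrm (y - z)"
  using nrm_triangle[of "x - y" "y - z"] assms by simp

lemma nrm_le_diff:
  assumes "x \<in> V" "y \<in> V"
  shows "nrm x \<le> nrm (x - y) + nrm y"
  using nrm_triangle[of "x - y" y] assms by simp

lemma nrm_sum:
  assumes "\<And>b. b \<in> B \<Longrightarrow> \<phi> b \<in> V"
  shows "nrm (sum \<phi> B) \<le> (\<Sum>b\<in>B. nrm (\<phi> b))"
  using assms
proof (induction B rule: infinite_finite_induct)
  case (insert b B)
  then show ?case
    using nrm_triangle[of "\<phi> b" "sum \<phi> B"] by (simp add: sum_in_V)
qed (simp_all add: nrm_zero)

lemma nrm_avg: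
  assumes "\<And>u. u \<in> S \<Longrightarrow> \<phi> u \<in> V"
  shows "nrm (avg S \<phi>) \<le> avg S (\<lambda>u. nrm (\<phi> u))"
  using nrm_sum[of S \<phi>] assms by (simp add: avg_def nrm_scaleR sum_in_V divide_right_mono)

lemma nrm_avg_le:
  assumes "finite S" "S \<noteq> {}" "\<And>u. u \<in> S \<Longrightarrow> \<phi> u \<in> V" "\<And>u. u \<in> S \<Longrightarrow> nrm (\<phi> u) \<le> C"
  shows "nrm (avg S \<phi>) \<le> C"
  using nrm_avg[of S \<phi>] avg_mono[of S "\<lambda>u. nrm (\<phi> u)" "\<lambda>_. C"] assms by (simp add: avg_const)

text \<open>Jensen's inequality for the square of the norm.\<close>
lemma nrm_avg_sq:
  assumes "finite S" "\<And>u. u \<in> S \<Longrightarrow> \<phi> u \<in> V"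
  shows "(nrm (avg S \<phi>))\<^sup>2 \<le> avg S (\<lambda>u. ip (\<phi> u) (\<phi> u))"
proof (cases "S = {}")
  case False
  have "(nrm (avg S \<phi>))\<^sup>2 \<le> (avg S (\<lambda>u. nrm (\<phi> u)))\<^sup>2"
    using assms by (intro power_mono nrm_avg nrm_nonneg) auto
  also have "\<dots> \<le> avg S (\<lambda>u. (nrm (\<phi> u))\<^sup>2)"
  proof -
    have "card S > 0" using False assms by (simp add: card_gt_0_iff)
    then show ?thesis
      using sum_squared_le_sum_of_squares[of "\<lambda>u. nrm (\<phi> u)" S]
      by (simp add: avg_def power_divide power2_eq_square field_simps)
  qed
  also have "\<dots> = avg S (\<lambda>u. ip (\<phi> u) (\<phi> u))"
    using assms by (simp add: avg_def nrm_sq)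
  finally show ?thesis .
qed (simp add: avg_def nrm_zero)

definition isometry :: "('v \<Rightarrow> 'v) \<Rightarrow> bool" where
  "isometry U \<longleftrightarrow> linear U \<and> (\<forall>x\<in>V. U x \<in> V) \<and> (\<forall>x\<in>V. \<forall>y\<in>V. ip (U x) (U y) = ip x y)"

lemma isometry_nrm: "isometry U \<Longrightarrow> x \<in> V \<Longrightarrow> nrm (U x) = nrm x"
  by (simp add: isometry_def nrm_def)

lemma parallelogram:
  assumes "x \<in> V" "y \<in> V"
  shows "(nrm (x - y))\<^sup>2 + 4 * (nrm ((1/2) *\<^sub>R x + (1/2) *\<^sub>R y))\<^sup>2 = 2 * (nrm x)\<^sup>2 + 2 * (nrm y)\<^sup>2"
  using assms by (simp add: nrm_sq ip_simps ip_commute[of y x] field_simps)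

lemma ip_null_right:
  assumes "x \<in> V" "y \<in> V" "nrm y = 0"
  shows "ip x y = 0"
  using Cauchy_Schwarz[OF assms(1,2)] assms(3) by simp

lemma nrm_null_combination:
  assumes "x \<in> V" "y \<in> V" "nrm x = 0" "nrm y = 0"
  shows "nrm (a *\<^sub>R x + b *\<^sub>R y) = 0"
  using nrm_triangle[of "a *\<^sub>R x" "b *\<^sub>R y"] nrm_nonneg[of "a *\<^sub>R x + b *\<^sub>R y"] assms
  by (simp add: nrm_scaleR)

lemma nrm_null_diff:
  assumes "x \<in> V" "y \<in> V" "nrm (x - y) = 0"
  shows "nrm x = nrm y"
proof (rule antisym)
  show "nrm x \<le> nrm y"
    using nrm_le_diff[of x y] assms by simp
  show "nrm y \<le> nrm x"
    using nrm_le_diff[of y x] nrm_minus_commute[of x y] assms by simp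
qed

text \<open>
  The vectors with a prescribed inner product with \<open>h\<close> form a closed convex set. This is how
  a limit of convex combinations of \<open>U f\<close> with unitary \<open>U\<close> inherits from \<open>f\<close> its inner products
  with invariant vectors.
\<close>
lemma ip_hull_limit:
  assumes Ob: "Ob \<subseteq> V" and V: "f \<in> V" "m \<in> V" "h \<in> V"
    and ip: "\<And>x. x \<in> Ob \<Longrightarrow> ip x h = ip f h"
    and m: "\<And>e. 0 < e \<Longrightarrow> \<exists>c \<in> convex hull Ob. nrm (c - m) < e"
  shows "ip m h = ip f h"
proof -
  let ?S = "{c \<in> V. ip c h = ip f h}"
  have "convex ?S"
  proof (intro convexI CollectI conjI)
    fix x y :: 'v and a b :: real
    assume xy: "x \<in> ?S" "y \<in> ?S" and ab: "0 \<le> a" "0 \<le> b" "a + b = 1"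
    have "a * ip f h + b * ip f h = ip f h"
      using ab by (metis distrib_right mult_1)
    then show "ip (a *\<^sub>R x + b *\<^sub>R y) h = ip f h"
      using xy V by (simp add: ip_simps)
  qed auto
  then have hull: "convex hull Ob \<subseteq> ?S"
    using Ob ip by (intro hull_minimal) auto
  have "\<bar>ip m h - ip f h\<bar> \<le> e" if "0 < e" for e
  proof -
    have "0 < e / (nrm h + 1)"
      using that nrm_nonneg[OF V(3)] by simp
    then obtain c where c: "c \<in> convex hull Ob" "nrm (c - m) < e / (nrm h + 1)"
      using m by blast
    have cS: "c \<in> V" "ip c h = ip f h"
      using hull c(1) by auto
    have "\<bar>ip m h - ip f h\<bar> = \<bar>ip (c - m) h\<bar>"
      using cS V by (simp add: ip_diff_left abs_minus_commute)
    also have "\<dots> \<le> nrm (c - m) * nrm h"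
      using cS V by (intro Cauchy_Schwarz) auto
    also have "\<dots> \<le> e / (nrm h + 1) * (nrm h + 1)"
      using c(2) cS V nrm_nonneg[of h] nrm_nonneg[of "c - m"] by (intro mult_mono) auto
    also have "\<dots> = e"
      using nrm_nonneg[OF V(3)] by simp
    finally show ?thesis .
  qed
  then have "\<bar>ip m h - ip f h\<bar> \<le> 0"
    using field_le_epsilon[of "\<bar>ip m h - ip f h\<bar>" 0] by simp
  then show ?thesis
    by simp
qed

end

section \<open>Averages along almost invariant sets\<close>

text \<open>
  Injectivity of \<open>\<sigma>\<close> makes the two sets \<open>F N\<close> and \<open>\<sigma> ` F N\<close> equally large, so that the one
  ratio controls both parts of their symmetric difference.
\<close>
definition almost_invariant :: "(nat \<Rightarrow> 'k set) \<Rightarrow> ('k \<Rightarrow> 'k) \<Rightarrow> bool" where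
  "almost_invariant F \<sigma> \<longleftrightarrow> inj \<sigma> \<and>
     (\<lambda>N. real (card (F N \<inter> \<sigma> ` F N)) / real (card (F N))) \<longlonglongrightarrow> 1"

locale averaging = semi_inner_space V ip
  for V :: "'v::real_vector set" and ip +
  fixes F :: "nat \<Rightarrow> 'k set"
  assumes F_finite [simp]: "\<And>N. finite (F N)" and F_nonempty [simp]: "\<And>N. F N \<noteq> {}"
begin

lemma card_F_pos: "0 < card (F N)"
  by (simp add: card_gt_0_iff)

text \<open>
  The two sums agree on \<open>F N \<inter> \<sigma> ` F N\<close>, so the averages differ by at most \<open>C\<close> times the proportion
  of the symmetric difference.
\<close>
lemma avg_shift:
  assumes \<sigma>: "almost_invariant F \<sigma>" and V: "\<And>u. \<phi> u \<in> V" and C: "\<And>u. nrm (\<phi> u) \<le> C"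
  shows "(\<lambda>N. nrm (avg (F N) (\<lambda>u. \<phi> (\<sigma> u)) - avg (F N) \<phi>)) \<longlonglongrightarrow> 0"
proof (rule tendsto_sandwich[where f = "\<lambda>_. 0"])
  let ?r = "\<lambda>N. real (card (F N \<inter> \<sigma> ` F N)) / real (card (F N))"
  have inj: "inj_on \<sigma> S" for S
    using \<sigma> by (auto simp: almost_invariant_def intro: inj_on_subset)
  show "\<forall>\<^sub>F N in sequentially. nrm (avg (F N) (\<lambda>u. \<phi> (\<sigma> u)) - avg (F N) \<phi>) \<le> 2 * C * (1 - ?r N)"
  proof (intro always_eventually allI)
    fix N
    let ?A = "\<sigma> ` F N" and ?n = "real (card (F N))"
    have "avg (F N) (\<lambda>u. \<phi> (\<sigma> u)) - avg (F N) \<phi> = (1 / ?n) *\<^sub>R (sum \<phi> ?A - sum \<phi> (F N))"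
      by (simp add: avg_def scaleR_diff_right sum.reindex[OF inj] o_def)
    also have "sum \<phi> ?A - sum \<phi> (F N) = sum \<phi> (?A - F N) - sum \<phi> (F N - ?A)"
      using sum.Int_Diff[of ?A \<phi> "F N"] sum.Int_Diff[of "F N" \<phi> ?A] by (simp add: Int_commute)
    also have "nrm ((1 / ?n) *\<^sub>R \<dots>) = nrm (sum \<phi> (?A - F N) - sum \<phi> (F N - ?A)) / ?n"
      using V by (simp add: nrm_scaleR)
    also have "\<dots> \<le> (real (card (?A - F N)) * C + real (card (F N - ?A)) * C) / ?n"
    proof (intro divide_right_mono)
      have bound: "nrm (sum \<phi> B) \<le> real (card B) * C" for B
        using nrm_sum[of B \<phi>] sum_bounded_above[of B "\<lambda>u. nrm (\<phi> u)" C] C V by (fastforce intro: order_trans)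
      have "nrm (sum \<phi> (?A - F N) - sum \<phi> (F N - ?A)) \<le> nrm (sum \<phi> (?A - F N)) + nrm (sum \<phi> (F N - ?A))"
        using nrm_triangle[of "sum \<phi> (?A - F N)" "- sum \<phi> (F N - ?A)"] V
        by (simp add: nrm_uminus)
      then show "nrm (sum \<phi> (?A - F N) - sum \<phi> (F N - ?A)) \<le> real (card (?A - F N)) * C + real (card (F N - ?A)) * C"
        using bound[of "?A - F N"] bound[of "F N - ?A"] by linarith
    qed simp
    also have "\<dots> = 2 * C * (1 - ?r N)"
    proof -
      have "card ?A = card (F N)"
        by (rule card_image[OF inj])
      then have "real (card (?A - F N)) = ?n - real (card (F N \<inter> ?A))"
        "real (card (F N - ?A)) = ?n - real (card (F N \<inter> ?A))"
        by (simp_all add: card_Diff_subset_Int Int_commute of_nat_diff card_mono)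
      then show ?thesis
        using card_F_pos[of N] by (simp only:) (simp add: field_simps)
    qed
    finally show "nrm (avg (F N) (\<lambda>u. \<phi> (\<sigma> u)) - avg (F N) \<phi>) \<le> 2 * C * (1 - ?r N)" .
  qed
  have "?r \<longlonglongrightarrow> 1"
    using \<sigma> by (simp add: almost_invariant_def)
  then have "(\<lambda>N. 2 * C * (1 - ?r N)) \<longlonglongrightarrow> 2 * C * (1 - 1)"
    by (intro tendsto_intros)
  then show "(\<lambda>N. 2 * C * (1 - ?r N)) \<longlonglongrightarrow> 0"
    by simp
qed (use V in \<open>auto intro!: nrm_nonneg always_eventually\<close>)

text \<open>
  By almost invariance the average of \<open>\<phi>\<close> hardly changes when \<open>\<phi>\<close> is replaced by the mean \<open>\<psi>\<close> of
  \<open>n\<close> of its shifts. Jensen's inequality bounds the squared norm of the average of \<open>\<psi>\<close> by the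
  average of \<open>ip (\<psi> u) (\<psi> u)\<close>, which expands to \<open>n\<^sup>2\<close> correlations with total weight one. The
  off-diagonal ones vanish in the limit and the \<open>n\<close> diagonal ones contribute at most \<open>C\<^sup>2 / n\<close>.
\<close>
lemma van_der_Corput:
  assumes V: "\<And>u. \<phi> u \<in> V" and C: "\<And>u. nrm (\<phi> u) \<le> C"
    and B: "infinite B" and \<sigma>: "\<And>b. b \<in> B \<Longrightarrow> almost_invariant F (\<sigma> b)"
    and off_diagonal: "\<And>b c. b \<in> B \<Longrightarrow> c \<in> B \<Longrightarrow> b \<noteq> c \<Longrightarrow>
      (\<lambda>N. avg (F N) (\<lambda>u. ip (\<phi> (\<sigma> b u)) (\<phi> (\<sigma> c u)))) \<longlonglongrightarrow> 0"
  shows "(\<lambda>N. nrm (avg (F N) \<phi>)) \<longlonglongrightarrow> 0"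
proof (rule LIMSEQ_I)
  fix e :: real
  assume "0 < e"
  have "(\<lambda>n. C\<^sup>2 / real (Suc n)) \<longlonglongrightarrow> 0"
    by (rule LIMSEQ_Suc[OF lim_const_over_n])
  then have "\<forall>\<^sub>F n in sequentially. C\<^sup>2 / real (Suc n) < (e / 2)\<^sup>2 / 2"
    using \<open>0 < e\<close> by (intro order_tendstoD) auto
  then obtain n0 where n0: "C\<^sup>2 / real (Suc n0) < (e / 2)\<^sup>2 / 2"
    by (auto simp: eventually_sequentially)
  define n where "n = Suc n0"
  obtain B' where B': "finite B'" "card B' = n" "B' \<subseteq> B"
    using infinite_arbitrarily_large[OF B] by blast
  have n: "real n > 0"
    by (simp add: n_def)
  define \<psi> where "\<psi> u = (1 / real n) *\<^sub>R (\<Sum>b\<in>B'. \<phi> (\<sigma> b u))" for u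
  define r where "r N = (\<Sum>b\<in>B'. \<Sum>c\<in>B' - {b}. avg (F N) (\<lambda>u. ip (\<phi> (\<sigma> b u)) (\<phi> (\<sigma> c u)))) / (real n)\<^sup>2" for N
  have \<psi>V: "\<psi> u \<in> V" for u
    using V by (auto simp: \<psi>_def)
  have "r \<longlonglongrightarrow> (\<Sum>b\<in>B'. \<Sum>c\<in>B' - {b}. 0) / (real n)\<^sup>2"
    unfolding r_def using B' n by (intro tendsto_intros off_diagonal) auto
  then have r: "r \<longlonglongrightarrow> 0"
    by simp
  have close: "(\<lambda>N. nrm (avg (F N) \<psi> - avg (F N) \<phi>)) \<longlonglongrightarrow> 0"
  proof (rule tendsto_sandwich[where f = "\<lambda>_. 0"])
    let ?d = "\<lambda>b N. avg (F N) (\<lambda>u. \<phi> (\<sigma> b u)) - avg (F N) \<phi>"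
    have "(\<lambda>N. (\<Sum>b\<in>B'. nrm (?d b N)) / real n) \<longlonglongrightarrow> (\<Sum>b\<in>B'. 0) / real n"
      using B' n \<sigma> by (intro tendsto_intros avg_shift[OF _ V C]) auto
    then show "(\<lambda>N. (\<Sum>b\<in>B'. nrm (?d b N)) / real n) \<longlonglongrightarrow> 0"
      by simp
    show "\<forall>\<^sub>F N in sequentially. nrm (avg (F N) \<psi> - avg (F N) \<phi>) \<le> (\<Sum>b\<in>B'. nrm (?d b N)) / real n"
    proof (intro always_eventually allI)
      fix N
      have "avg (F N) \<psi> - avg (F N) \<phi> = (1 / real n) *\<^sub>R (\<Sum>b\<in>B'. ?d b N)"
        using B' n unfolding \<psi>_def[abs_def] by (simp add: avg_scaleR avg_sum sum_subtractf scaleR_diff_right sum_constant_scaleR)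
      then show "nrm (avg (F N) \<psi> - avg (F N) \<phi>) \<le> (\<Sum>b\<in>B'. nrm (?d b N)) / real n"
        using nrm_sum[of B' "\<lambda>b. ?d b N"] V n by (simp add: nrm_scaleR divide_right_mono)
    qed
  qed (use V \<psi>V in \<open>auto intro!: nrm_nonneg always_eventually\<close>)
  have ip_\<psi>: "ip (\<psi> u) (\<psi> u) = (1 / (real n)\<^sup>2) *\<^sub>R (\<Sum>b\<in>B'. \<Sum>c\<in>B'. ip (\<phi> (\<sigma> b u)) (\<phi> (\<sigma> c u)))" for u
  proof -
    let ?s = "\<Sum>b\<in>B'. \<phi> (\<sigma> b u)"
    have s: "?s \<in> V"
      using V by auto
    have "ip (\<psi> u) (\<psi> u) = (1 / (real n)\<^sup>2) * ip ?s ?s"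
      using s by (simp add: \<psi>_def ip_scaleR_left ip_scaleR_right power2_eq_square)
    also have "ip ?s ?s = (\<Sum>b\<in>B'. ip (\<phi> (\<sigma> b u)) ?s)"
      using V s by (intro ip_sum_left) auto
    also have "\<dots> = (\<Sum>b\<in>B'. \<Sum>c\<in>B'. ip (\<phi> (\<sigma> b u)) (\<phi> (\<sigma> c u)))"
      using V by (intro sum.cong ip_sum_right) auto
    finally show ?thesis
      by simp
  qed
  have sq: "(nrm (avg (F N) \<psi>))\<^sup>2 \<le> C\<^sup>2 / real n + r N" for N
  proof -
    have "(nrm (avg (F N) \<psi>))\<^sup>2 \<le> avg (F N) (\<lambda>u. ip (\<psi> u) (\<psi> u))"
      using \<psi>V by (intro nrm_avg_sq) auto
    also have "\<dots> = avg (F N) (\<lambda>u. (1 / (real n)\<^sup>2) *\<^sub>R (\<Sum>b\<in>B'. \<Sum>c\<in>B'. ip (\<phi> (\<sigma> b u)) (\<phi> (\<sigma> c u))))"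
      by (simp add: ip_\<psi>)
    also have "\<dots> = (\<Sum>b\<in>B'. \<Sum>c\<in>B'. avg (F N) (\<lambda>u. ip (\<phi> (\<sigma> b u)) (\<phi> (\<sigma> c u)))) / (real n)\<^sup>2"
      by (simp only: avg_scaleR avg_sum) simp
    also have "\<dots> = (\<Sum>b\<in>B'. avg (F N) (\<lambda>u. ip (\<phi> (\<sigma> b u)) (\<phi> (\<sigma> b u)))) / (real n)\<^sup>2 + r N"
    proof -
      let ?f = "\<lambda>b c. avg (F N) (\<lambda>u. ip (\<phi> (\<sigma> b u)) (\<phi> (\<sigma> c u)))"
      have "(\<Sum>b\<in>B'. \<Sum>c\<in>B'. ?f b c) = (\<Sum>b\<in>B'. ?f b b + (\<Sum>c\<in>B' - {b}. ?f b c))"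
        using B'(1) by (intro sum.cong refl sum.remove)
      then show ?thesis
        by (simp add: r_def sum.distrib add_divide_distrib)
    qed
    also have "\<dots> \<le> (\<Sum>b\<in>B'. C\<^sup>2) / (real n)\<^sup>2 + r N"
    proof (intro add_right_mono divide_right_mono sum_mono)
      fix b
      have "ip (\<phi> v) (\<phi> v) \<le> C\<^sup>2" for v
        using C V by (simp flip: nrm_sq add: power_mono nrm_nonneg)
      then show "avg (F N) (\<lambda>u. ip (\<phi> (\<sigma> b u)) (\<phi> (\<sigma> b u))) \<le> C\<^sup>2"
        using avg_mono[of "F N" "\<lambda>u. ip (\<phi> (\<sigma> b u)) (\<phi> (\<sigma> b u))" "\<lambda>_. C\<^sup>2"] by (simp add: avg_const)
    qed simp
    also have "\<dots> = C\<^sup>2 / real n + r N"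
      using B' n by (simp add: power2_eq_square)
    finally show ?thesis .
  qed
  have "\<forall>\<^sub>F N in sequentially. r N < (e / 2)\<^sup>2 / 2"
    using \<open>0 < e\<close> by (intro order_tendstoD(2)[OF r]) simp
  moreover have "\<forall>\<^sub>F N in sequentially. nrm (avg (F N) \<psi> - avg (F N) \<phi>) < e / 2"
    using \<open>0 < e\<close> by (intro order_tendstoD(2)[OF close]) simp
  ultimately have "\<forall>\<^sub>F N in sequentially. norm (nrm (avg (F N) \<phi>) - 0) < e"
  proof eventually_elim
    case (elim N)
    have "(nrm (avg (F N) \<psi>))\<^sup>2 < (e / 2)\<^sup>2"
      using sq[of N] elim(1) n0 unfolding n_def by linarith
    then have "nrm (avg (F N) \<psi>) < e / 2"
      using \<open>0 < e\<close> power2_less_imp_less[of "nrm (avg (F N) \<psi>)" "e / 2"] by simp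
    moreover have "nrm (avg (F N) \<phi>) \<le> nrm (avg (F N) \<phi> - avg (F N) \<psi>) + nrm (avg (F N) \<psi>)"
      using V \<psi>V by (intro nrm_le_diff) auto
    moreover have "nrm (avg (F N) \<phi> - avg (F N) \<psi>) = nrm (avg (F N) \<psi> - avg (F N) \<phi>)"
      using V \<psi>V by (intro nrm_minus_commute) auto
    ultimately show ?case
      using elim(2) V nrm_nonneg[of "avg (F N) \<phi>"] by simp
  qed
  then show "\<exists>no. \<forall>N\<ge>no. norm (nrm (avg (F N) \<phi>) - 0) < e"
    by (simp add: eventually_sequentially)
qed


text \<open>
  The vectors \<open>c\<close> with this property form a convex set, and it contains \<open>Ob\<close> because replacing \<open>g\<close>
  by a member of \<open>Ob\<close> amounts to a shift of the averaging variable.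
\<close>
lemma avg_convex_hull:
  assumes W: "\<And>u. linear (W u)" "\<And>u x. x \<in> V \<Longrightarrow> W u x \<in> V" "\<And>u x. x \<in> V \<Longrightarrow> nrm (W u x) \<le> nrm x"
    and g: "g \<in> V" and Ob: "Ob \<subseteq> V"
    and orbit: "\<And>h. h \<in> Ob \<Longrightarrow> \<exists>\<sigma>. almost_invariant F \<sigma> \<and> (\<forall>u. W u h = W (\<sigma> u) g)"
    and c: "c \<in> convex hull Ob"
  shows "(\<lambda>N. nrm (avg (F N) (\<lambda>u. W u c) - avg (F N) (\<lambda>u. W u g))) \<longlonglongrightarrow> 0"
proof -
  let ?d = "\<lambda>c N. avg (F N) (\<lambda>u. W u c) - avg (F N) (\<lambda>u. W u g)"
  let ?S = "{c \<in> V. (\<lambda>N. nrm (?d c N)) \<longlonglongrightarrow> 0}"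
  have "Ob \<subseteq> ?S"
  proof
    fix h assume "h \<in> Ob"
    then obtain \<sigma> where "almost_invariant F \<sigma>" "\<And>u. W u h = W (\<sigma> u) g"
      using orbit by blast
    then have "(\<lambda>N. nrm (?d h N)) \<longlonglongrightarrow> 0"
      using avg_shift[of \<sigma> "\<lambda>u. W u g" "nrm g"] W g by simp
    then show "h \<in> ?S"
      using \<open>h \<in> Ob\<close> Ob by auto
  qed
  moreover have "convex ?S"
  proof (intro convexI)
    fix x y :: 'v and a b :: real
    assume x: "x \<in> ?S" and y: "y \<in> ?S" and ab: "0 \<le> a" "0 \<le> b" "a + b = 1"
    have V: "?d x N \<in> V" "?d y N \<in> V" for N
      using x y g W by auto
    have "?d (a *\<^sub>R x + b *\<^sub>R y) N = a *\<^sub>R ?d x N + b *\<^sub>R ?d y N" for N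
    proof -
      have "a *\<^sub>R avg (F N) (\<lambda>u. W u g) + b *\<^sub>R avg (F N) (\<lambda>u. W u g) = avg (F N) (\<lambda>u. W u g)"
        using ab by (metis scaleR_add_left scaleR_one)
      then have "a *\<^sub>R ?d x N + b *\<^sub>R ?d y N
          = a *\<^sub>R avg (F N) (\<lambda>u. W u x) + b *\<^sub>R avg (F N) (\<lambda>u. W u y) - avg (F N) (\<lambda>u. W u g)"
        by (simp only: scaleR_diff_right add_diff_add[symmetric])
      moreover have "avg (F N) (\<lambda>u. W u (a *\<^sub>R x + b *\<^sub>R y))
          = a *\<^sub>R avg (F N) (\<lambda>u. W u x) + b *\<^sub>R avg (F N) (\<lambda>u. W u y)"
        by (simp only: linear_add[OF W(1)] linear_scale[OF W(1)] avg_add avg_scaleR)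
      ultimately show ?thesis
        by (simp only:)
    qed
    then have "nrm (?d (a *\<^sub>R x + b *\<^sub>R y) N) \<le> a * nrm (?d x N) + b * nrm (?d y N)" for N
      using nrm_triangle[of "a *\<^sub>R ?d x N" "b *\<^sub>R ?d y N"] V ab by (simp add: nrm_scaleR)
    moreover have "(\<lambda>N. a * nrm (?d x N) + b * nrm (?d y N)) \<longlonglongrightarrow> 0"
      using x y by (intro tendsto_add_zero tendsto_mult_right_zero) auto
    moreover have "0 \<le> nrm (?d (a *\<^sub>R x + b *\<^sub>R y) N)" for N
      using x y W g by (intro nrm_nonneg) auto
    ultimately have "(\<lambda>N. nrm (?d (a *\<^sub>R x + b *\<^sub>R y) N)) \<longlonglongrightarrow> 0"
      by (rule null_sequence_le[rotated])
    then show "a *\<^sub>R x + b *\<^sub>R y \<in> ?S"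
      using x y by auto
  qed
  ultimately have "convex hull Ob \<subseteq> ?S"
    by (rule hull_minimal)
  then show ?thesis
    using c by auto
qed

text \<open>
  The identification of ergodic averages: their limit does not change when \<open>g\<close> is replaced by
  a point \<open>m\<close> of the closed convex hull of its orbit, for which the averages are easy to compute.
\<close>
lemma avg_orbit_limit:
  assumes W: "\<And>u. linear (W u)" "\<And>u x. x \<in> V \<Longrightarrow> W u x \<in> V" "\<And>u x. x \<in> V \<Longrightarrow> nrm (W u x) \<le> nrm x"
    and g: "g \<in> V" and Ob: "Ob \<subseteq> V"
    and orbit: "\<And>h. h \<in> Ob \<Longrightarrow> \<exists>\<sigma>. almost_invariant F \<sigma> \<and> (\<forall>u. W u h = W (\<sigma> u) g)"
    and m: "m \<in> V" "\<And>e. 0 < e \<Longrightarrow> \<exists>c \<in> convex hull Ob. nrm (c - m) < e"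
  shows "(\<lambda>N. nrm (avg (F N) (\<lambda>u. W u g) - avg (F N) (\<lambda>u. W u m))) \<longlonglongrightarrow> 0"
proof (rule LIMSEQ_I)
  fix e :: real
  assume "0 < e"
  then obtain c where c: "c \<in> convex hull Ob" "nrm (c - m) < e / 2"
    using m(2)[of "e / 2"] by auto
  have cV: "c \<in> V"
    using convex_hull_in_V[OF Ob c(1)] .
  let ?a = "\<lambda>x N. avg (F N) (\<lambda>u. W u x)"
  have aV: "?a x N \<in> V" if "x \<in> V" for x N
    using W that by auto
  have "\<forall>\<^sub>F N in sequentially. nrm (?a c N - ?a g N) < e / 2"
    using avg_convex_hull[OF W g Ob orbit c(1)] \<open>0 < e\<close> by (intro order_tendstoD(2)) auto
  then have "\<forall>\<^sub>F N in sequentially. norm (nrm (?a g N - ?a m N) - 0) < e"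
  proof eventually_elim
    case (elim N)
    have "?a c N - ?a m N = ?a (c - m) N"
      by (simp add: linear_diff[OF W(1)] avg_diff)
    moreover have "nrm (?a (c - m) N) \<le> nrm (c - m)"
      using W cV m by (intro nrm_avg_le) auto
    moreover have "nrm (?a g N - ?a m N) \<le> nrm (?a g N - ?a c N) + nrm (?a c N - ?a m N)"
      using aV g cV m(1) by (intro nrm_triangle_diff) auto
    moreover have "nrm (?a g N - ?a c N) = nrm (?a c N - ?a g N)"
      using aV g cV by (intro nrm_minus_commute) auto
    ultimately show ?case
      using elim c(2) aV g m(1) nrm_nonneg[of "?a g N - ?a m N"] by simp
  qed
  then show "\<exists>no. \<forall>N\<ge>no. norm (nrm (?a g N - ?a m N) - 0) < e"
    by (simp add: eventually_sequentially)
qed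

end

section \<open>The mean ergodic theorem\<close>

locale semi_hilbert = semi_inner_space V ip
  for V :: "'v::real_vector set" and ip +
  assumes complete: "\<lbrakk>\<And>n. X n \<in> V; \<And>e. 0 < e \<Longrightarrow> \<exists>n0. \<forall>m\<ge>n0. \<forall>n\<ge>n0. nrm (X m - X n) < e\<rbrakk>
    \<Longrightarrow> \<exists>l\<in>V. (\<lambda>n::nat. nrm (X n - l)) \<longlonglongrightarrow> 0"
begin

text \<open>
  The argument of Alaoglu and Birkhoff: \<open>m\<close> is the vector of minimal norm in the closed convex hull
  of \<open>Ob\<close>. By the parallelogram law, any two vectors of the hull with almost minimal norm are close
  to each other. Hence a minimising sequence \<open>c\<close> converges, and since \<open>U (c n)\<close> is again in the hull
  with the same norm as \<open>c n\<close>, the limit is invariant under \<open>U\<close>.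
\<close>
lemma mean_ergodic:
  assumes Ob: "Ob \<subseteq> V" "Ob \<noteq> {}" and iso: "\<And>U. U \<in> \<U> \<Longrightarrow> isometry U"
    and inv: "\<And>U. U \<in> \<U> \<Longrightarrow> U ` Ob \<subseteq> Ob"
  obtains m where "m \<in> V" and "\<And>U. U \<in> \<U> \<Longrightarrow> nrm (U m - m) = 0"
    and "\<And>e. 0 < e \<Longrightarrow> \<exists>c \<in> convex hull Ob. nrm (c - m) < e"
proof -
  define C where "C = convex hull Ob"
  have CV: "x \<in> V" if "x \<in> C" for x
    using convex_hull_in_V[OF Ob(1)] that by (simp add: C_def)
  have C_inv: "U x \<in> C" if "U \<in> \<U>" "x \<in> C" for U x
  proof -
    have "U x \<in> convex hull (U ` Ob)"
      using iso[OF that(1)] that(2) by (intro in_convex_hull_linear_image) (auto simp: isometry_def C_def)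
    then show ?thesis
      using hull_mono[OF inv[OF that(1)]] by (auto simp: C_def)
  qed
  define I where "I = Inf (nrm ` C)"
  have bdd: "bdd_below (nrm ` C)"
    using CV by (intro bdd_belowI2[of _ 0]) (auto intro: nrm_nonneg)
  have I_le: "I \<le> nrm x" if "x \<in> C" for x
    using that bdd by (auto simp: I_def intro: cInf_lower)
  have "C \<noteq> {}"
    using Ob(2) by (simp add: C_def)
  have "0 \<le> I"
    unfolding I_def using CV \<open>C \<noteq> {}\<close> by (intro cInf_greatest) (auto intro: nrm_nonneg)
  \<comment> \<open>The midpoint of \<open>x\<close> and \<open>y\<close> has norm at least \<open>I\<close>, so the parallelogram law leaves
    \<open>4 (I + d)\<^sup>2 - 4 I\<^sup>2\<close> for the difference.\<close>
  have diff_bound: "(nrm (x - y))\<^sup>2 \<le> 8 * I * d + 4 * d\<^sup>2"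
    if "x \<in> C" "y \<in> C" "nrm x \<le> I + d" "nrm y \<le> I + d" for x y d
  proof -
    have "(1/2) *\<^sub>R x + (1/2) *\<^sub>R y \<in> C"
      using that by (auto simp: C_def intro: convexD[OF convex_convex_hull])
    then have "I\<^sup>2 \<le> (nrm ((1/2) *\<^sub>R x + (1/2) *\<^sub>R y))\<^sup>2"
      using I_le \<open>0 \<le> I\<close> by (intro power_mono) auto
    moreover have "(nrm x)\<^sup>2 \<le> (I + d)\<^sup>2" "(nrm y)\<^sup>2 \<le> (I + d)\<^sup>2"
      using that CV by (auto intro!: power_mono nrm_nonneg)
    ultimately have "(nrm (x - y))\<^sup>2 \<le> 4 * (I + d)\<^sup>2 - 4 * I\<^sup>2"
      using parallelogram[of x y] CV that by simp
    then show ?thesis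
      by (simp add: power2_eq_square algebra_simps)
  qed
  have "\<exists>x\<in>C. nrm x \<le> I + 1 / real (Suc n)" for n
    using cInf_lessD[of "nrm ` C" "I + 1 / real (Suc n)"] \<open>C \<noteq> {}\<close> by (force simp: I_def)
  then obtain c where c: "\<And>n. c n \<in> C" "\<And>n. nrm (c n) \<le> I + 1 / real (Suc n)"
    by metis
  define g where "g n = sqrt (8 * I * (1 / real (Suc n)) + 4 * (1 / real (Suc n))\<^sup>2)" for n
  have "g \<longlonglongrightarrow> sqrt (8 * I * 0 + 4 * 0\<^sup>2)"
    unfolding g_def by (intro tendsto_intros LIMSEQ_Suc[OF lim_1_over_n])
  then have g: "g \<longlonglongrightarrow> 0"
    by simp
  have close: "nrm (x - y) \<le> g n"
    if "x \<in> C" "y \<in> C" "nrm x \<le> I + 1 / real (Suc n)" "nrm y \<le> I + 1 / real (Suc n)" for x y n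
    unfolding g_def using that by (intro real_le_rsqrt diff_bound)
  have "\<exists>l\<in>V. (\<lambda>n. nrm (c n - l)) \<longlonglongrightarrow> 0"
  proof (rule complete)
    fix e :: real
    assume "0 < e"
    then obtain n0 where n0: "g n0 < e"
      using order_tendstoD(2)[OF g] by (auto simp: eventually_sequentially)
    have near: "nrm (c n) \<le> I + 1 / real (Suc n0)" if "n0 \<le> n" for n
      using that by (intro order_trans[OF c(2)[of n]] add_left_mono frac_le) auto
    show "\<exists>n0. \<forall>m\<ge>n0. \<forall>n\<ge>n0. nrm (c m - c n) < e"
      using close[OF c(1) c(1) near near] n0 by (intro exI[of _ n0]) (meson order_le_less_trans)
  qed (use c CV in auto)
  then obtain m where m: "m \<in> V" "(\<lambda>n. nrm (c n - m)) \<longlonglongrightarrow> 0"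
    by blast
  show thesis
  proof
    show "m \<in> V" by fact
    show "\<exists>c \<in> convex hull Ob. nrm (c - m) < e" if "0 < e" for e
      using order_tendstoD(2)[OF m(2) that] c(1) by (auto simp: eventually_sequentially C_def)
    show "nrm (U m - m) = 0" if "U \<in> \<U>" for U
    proof -
      note U = iso[OF that]
      have UV: "U x \<in> V" if "x \<in> V" for x
        using U that by (simp add: isometry_def)
      have "nrm (U m - m) \<le> 2 * nrm (c n - m) + g n" for n
      proof -
        have "nrm (U m - U (c n)) = nrm (c n - m)"
        proof -
          have "U m - U (c n) = U (m - c n)"
            using U linear_diff[of U m "c n"] by (simp add: isometry_def)
          then have "nrm (U m - U (c n)) = nrm (m - c n)"
            using m(1) CV[OF c(1)] by (simp add: isometry_nrm[OF U])
          also have "\<dots> = nrm (c n - m)"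
            using m(1) CV[OF c(1)] by (intro nrm_minus_commute)
          finally show ?thesis .
        qed
        moreover have "nrm (U (c n) - c n) \<le> g n"
          using close[OF C_inv[OF that c(1)] c(1) _ c(2)] c(2) isometry_nrm[OF U CV[OF c(1)]] by simp
        moreover have "nrm (U m - m) \<le> nrm (U m - U (c n)) + nrm (U (c n) - m)"
          "nrm (U (c n) - m) \<le> nrm (U (c n) - c n) + nrm (c n - m)"
          using m(1) CV[OF c(1)] UV by (auto intro!: nrm_triangle_diff)
        ultimately show ?thesis
          by linarith
      qed
      moreover have "(\<lambda>n. 2 * nrm (c n - m) + g n) \<longlonglongrightarrow> 2 * 0 + 0"
        by (intro tendsto_intros m(2) g)
      ultimately have "nrm (U m - m) \<le> 0"
        by (intro LIMSEQ_le_const) auto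
      then show ?thesis
        using m(1) UV nrm_nonneg[of "U m - m"] by simp
    qed
  qed
qed

end

section \<open>Degrees of polynomial differences\<close>

lemma coeff_pcompose_translate:
  fixes q :: "'k::comm_semiring_1 poly"
  shows "coeff (pcompose q [:b, 1:]) i = (\<Sum>k\<in>{i..degree q}. coeff q k * (of_nat (k choose i) * b ^ (k - i)))"
proof -
  have "pcompose q [:b, 1:] = (\<Sum>k\<le>degree q. smult (coeff q k) ([:b, 1:] ^ k))"
    by (simp add: pcompose_altdef poly_altdef degree_map_poly coeff_map_poly)
  also have "coeff \<dots> i = (\<Sum>k\<le>degree q. coeff q k * coeff ([:b, 1:] ^ k) i)"
    by (simp add: coeff_sum)
  also have "\<dots> = (\<Sum>k\<in>{i..degree q}. coeff q k * coeff ([:b, 1:] ^ k) i)"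
  proof (intro sum.mono_neutral_right ballI)
    fix k assume "k \<in> {..degree q} - {i..degree q}"
    then have "degree ([:b, 1:] ^ k) < i"
      using degree_power_le[of "[:b, 1:]" k] by auto
    then show "coeff q k * coeff ([:b, 1:] ^ k) i = 0"
      by (simp add: coeff_eq_0)
  qed auto
  finally show ?thesis
    by (simp add: coeff_linear_poly_power)
qed

text \<open>
  This is the point of admissibility: positive integers below the characteristic, or all of them in
  characteristic zero, are invertible in the field.
\<close>
lemma of_nat_degree_neq_0:
  fixes q :: "'k::field poly"
  assumes "admissible q"
  shows "of_nat (degree q) \<noteq> (0::'k)"
  using assms by (auto simp: admissible_def of_nat_eq_0_iff_char_dvd dest: dvd_imp_le)

text \<open>
  The leading terms cancel, and the next coefficient is \<open>lead_coeff q * degree q * (b - c)\<close>, as the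
  contributions of the second highest coefficient of \<open>q\<close> cancel too.
\<close>
lemma degree_translate_difference:
  fixes q :: "'k::field poly"
  assumes "admissible q" "b \<noteq> c"
  shows "degree (pcompose q [:b, 1:] - pcompose q [:c, 1:]) = degree q - 1"
proof -
  let ?d = "degree q" and ?r = "pcompose q [:b, 1:] - pcompose q [:c, 1:]"
  have d: "0 < ?d"
    using assms by (simp add: admissible_def)
  have "coeff ?r i = 0" if "?d - 1 < i" for i
  proof (cases "i = ?d")
    case False
    then show ?thesis
      using that by (simp add: coeff_pcompose_translate)
  qed (simp add: coeff_pcompose_translate)
  then have "degree ?r \<le> ?d - 1"
    by (intro degree_le) auto
  moreover have "coeff ?r (?d - 1) \<noteq> 0"
  proof -
    have "{?d - 1..?d} = {?d - 1, ?d}"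
      using d by auto
    moreover have "?d choose (?d - 1) = ?d"
      using d by (metis binomial_symmetric choose_one diff_le_self Suc_diff_1 diff_Suc_1 One_nat_def Suc_leI diff_diff_cancel)
    ultimately have "coeff ?r (?d - 1) = lead_coeff q * of_nat ?d * (b - c)"
      using d by (simp add: coeff_pcompose_translate algebra_simps)
    then show ?thesis
      using of_nat_degree_neq_0[OF assms(1)] assms d by auto
  qed
  ultimately show ?thesis
    using le_degree[of ?r "?d - 1"] by simp
qed

text \<open>The coefficients are those of \<open>p\<close>, multiplied by \<open>c ^ Suc i - b ^ Suc i\<close>.\<close>
lemma degree_dilate_difference:
  fixes p :: "'k::field poly"
  assumes "0 < degree p" "b ^ Suc (degree p) \<noteq> c ^ Suc (degree p)"
  shows "degree (smult c (pcompose p [:0, c:]) - smult b (pcompose p [:0, b:])) = degree p"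
proof (rule antisym)
  let ?r = "smult c (pcompose p [:0, c:]) - smult b (pcompose p [:0, b:])"
  have coeff: "coeff ?r i = (c ^ Suc i - b ^ Suc i) * coeff p i" for i
    by (simp add: coeff_pcompose_linear algebra_simps)
  show "degree ?r \<le> degree p"
    by (intro degree_le allI impI) (simp only: coeff coeff_eq_0 mult_zero_right)
  show "degree p \<le> degree ?r"
    using assms by (intro le_degree) (auto simp only: coeff mult_eq_0_iff leading_coeff_0_iff right_minus_eq degree_0)
qed

text \<open>
  The map \<open>b \<mapsto> b ^ n\<close> has finite fibres, namely sets of roots of polynomials, so its image is
  infinite and \<open>B\<close> can be chosen as a set of representatives of the fibres.
\<close>
lemma infinite_power_inj_on:
  assumes "infinite (UNIV :: 'k::field set)" "0 < n"
  obtains B where "infinite B" "0 \<notin> B" "inj_on (\<lambda>b::'k. b ^ n) B"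
proof -
  let ?f = "\<lambda>b::'k. b ^ n" and ?S = "UNIV - {0::'k}"
  have fibre: "finite {b. b ^ n = a}" for a :: 'k
  proof -
    have "monom 1 n - [:a:] \<noteq> (0 :: 'k poly)"
      using assms(2) by (metis coeff_diff coeff_monom coeff_pCons_Suc coeff_0 gr0_implies_Suc diff_zero zero_neq_one)
    then have "finite {b. poly (monom 1 n - [:a:]) b = 0}"
      by (rule poly_roots_finite)
    then show ?thesis
      by (simp add: poly_monom)
  qed
  have "infinite (?f ` ?S)"
  proof
    assume "finite (?f ` ?S)"
    then have "finite (\<Union>a\<in>?f ` ?S. {b. b ^ n = a})"
      using fibre by (intro finite_UN_I) auto
    moreover have "?S \<subseteq> (\<Union>a\<in>?f ` ?S. {b. b ^ n = a})"
      by auto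
    ultimately show False
      using assms(1) by (meson finite_subset finite_Diff2 finite.emptyI finite.insertI)
  qed
  moreover obtain B where "B \<subseteq> ?S" "inj_on ?f B" "?f ` ?S = ?f ` B"
    using subset_image_inj[of "?f ` ?S" ?f ?S] by auto
  ultimately show thesis
    using that[of B] by (metis Diff_iff finite_imageI singletonI subsetD)
qed

section \<open>Polynomial averages in representations of the affine group\<close>

text \<open>
  \<open>A v\<close> is the operator of the translation by \<open>v\<close> and \<open>D u\<close> that of the dilation by \<open>u\<close>. The
  dilation by \<open>0\<close> is not in the group; with \<open>D 0 = 0\<close> a sum over the nonzero elements of a set
  becomes a sum over the whole set, to which shifts of the variable apply.
\<close>
locale affine_representation = semi_hilbert V ip
  for V :: "'v::real_vector set" and ip +
  fixes A D :: "'k::field \<Rightarrow> 'v \<Rightarrow> 'v"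
  assumes isometry_A: "\<And>v. isometry (A v)"
    and isometry_D: "\<And>u. u \<noteq> 0 \<Longrightarrow> isometry (D u)"
    and D_zero: "\<And>x. D 0 x = 0"
    and A_zero: "\<And>x. x \<in> V \<Longrightarrow> A 0 x = x"
    and A_add: "\<And>v w x. x \<in> V \<Longrightarrow> A (v + w) x = A v (A w x)"
    and D_one: "\<And>x. x \<in> V \<Longrightarrow> D 1 x = x"
    and D_mult: "\<And>u w x. u \<noteq> 0 \<Longrightarrow> w \<noteq> 0 \<Longrightarrow> x \<in> V \<Longrightarrow> D (u * w) x = D u (D w x)"
    and D_A: "\<And>u v x. u \<noteq> 0 \<Longrightarrow> x \<in> V \<Longrightarrow> D u (A v x) = A (u * v) (D u x)"
begin

lemma linear_A: "linear (A v)"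
  using isometry_A by (simp add: isometry_def)

lemma linear_D: "linear (D u)"
proof (cases "u = 0")
  case True
  then show ?thesis
    using linear_zero by (simp add: D_zero[abs_def])
next
  case False
  then show ?thesis
    using isometry_D by (simp add: isometry_def)
qed

lemma A_in_V [simp, intro]: "x \<in> V \<Longrightarrow> A v x \<in> V"
  using isometry_A by (simp add: isometry_def)

lemma D_in_V [simp, intro]: "x \<in> V \<Longrightarrow> D u x \<in> V"
  using isometry_D by (cases "u = 0") (simp_all add: isometry_def D_zero)

lemma nrm_A: "x \<in> V \<Longrightarrow> nrm (A v x) = nrm x"
  by (rule isometry_nrm[OF isometry_A])

lemma nrm_D: "u \<noteq> 0 \<Longrightarrow> x \<in> V \<Longrightarrow> nrm (D u x) = nrm x"
  by (rule isometry_nrm[OF isometry_D])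

lemma nrm_D_le: "x \<in> V \<Longrightarrow> nrm (D u x) \<le> nrm x"
  by (cases "u = 0") (simp_all add: nrm_D D_zero nrm_zero nrm_nonneg)

lemma ip_A_A:
  assumes "x \<in> V" "y \<in> V"
  shows "ip (A v x) (A w y) = ip (A (v - w) x) y"
proof -
  have "A v x = A w (A (v - w) x)"
    using A_add[of x w "v - w"] assms by simp
  then show ?thesis
    using isometry_A[of w] assms by (simp add: isometry_def)
qed

lemma ip_D_D: "u \<noteq> 0 \<Longrightarrow> x \<in> V \<Longrightarrow> y \<in> V \<Longrightarrow> ip (D u x) (D u y) = ip x y"
  using isometry_D by (simp add: isometry_def)

definition invariant_vector :: "'v \<Rightarrow> bool" where
  "invariant_vector h \<longleftrightarrow>
     h \<in> V \<and> (\<forall>v. nrm (A v h - h) = 0) \<and> (\<forall>u. u \<noteq> 0 \<longrightarrow> nrm (D u h - h) = 0)"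

text \<open>
  This says that \<open>0\<close> is in the closed convex hull of the orbit under translations, a description of
  orthogonality to the translation invariant vectors that can be used without a projection.
\<close>
definition mean_zero :: "'v \<Rightarrow> bool" where
  "mean_zero g \<longleftrightarrow> (\<forall>e>0. \<exists>c \<in> convex hull (range (\<lambda>v. A v g)). nrm c < e)"

text \<open>Dilations normalise the translations, so \<open>D b\<close> maps the translation orbit of \<open>g\<close> onto that of
  \<open>D b g\<close>.\<close>
lemma mean_zero_D:
  assumes "mean_zero g" "g \<in> V" "b \<noteq> 0"
  shows "mean_zero (D b g)"
  unfolding mean_zero_def
proof (intro allI impI)
  fix e :: real
  assume "0 < e"
  then obtain c where c: "c \<in> convex hull (range (\<lambda>v. A v g))" "nrm c < e"
    using assms(1) by (auto simp: mean_zero_def)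
  have "D b ` range (\<lambda>v. A v g) \<subseteq> range (\<lambda>v. A v (D b g))"
    using assms by (auto simp: D_A)
  then have "convex hull (D b ` range (\<lambda>v. A v g)) \<subseteq> convex hull (range (\<lambda>v. A v (D b g)))"
    by (rule hull_mono)
  moreover have "D b c \<in> convex hull (D b ` range (\<lambda>v. A v g))"
    using linear_D c(1) by (rule in_convex_hull_linear_image)
  ultimately have "D b c \<in> convex hull (range (\<lambda>v. A v (D b g)))"
    by (rule subsetD)
  moreover have "c \<in> V"
    using c(1) assms(2) by (intro convex_hull_in_V[of "range (\<lambda>v. A v g)"]) auto
  then have "nrm (D b c) < e"
    using c(2) assms by (simp add: nrm_D)
  ultimately show "\<exists>c \<in> convex hull (range (\<lambda>v. A v (D b g))). nrm c < e"
    by blast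
qed

end

locale affine_averaging = affine_representation V ip A D + averaging V ip F
  for V :: "'v::real_vector set" and ip and A D :: "'k::field \<Rightarrow> 'v \<Rightarrow> 'v" and F :: "nat \<Rightarrow> 'k set" +
  assumes infinite_field: "infinite (UNIV :: 'k set)"
    and translation_invariant_nonzero: "\<And>v. v \<noteq> 0 \<Longrightarrow> almost_invariant F (\<lambda>y. v + y)"
    and dilation_invariant: "\<And>u. u \<noteq> 0 \<Longrightarrow> almost_invariant F (\<lambda>y. u * y)"
begin

lemma translation_invariant: "almost_invariant F (\<lambda>y. v + y)"
proof (cases "v = 0")
  case True
  have "card (F N) \<noteq> 0" for N
    using card_F_pos[of N] by simp
  then show ?thesis
    using True by (simp add: almost_invariant_def)
qed (rule translation_invariant_nonzero)

text \<open>
  A set with at most \<open>m\<close> elements that is moved by less than one element under a translation is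
  mapped onto itself. If that happens for \<open>m + 1\<close> translations at the same time, then the set
  contains \<open>m + 1\<close> translates of one of its points, which is absurd. The growth matters because it
  makes single terms of the averages, in particular those at \<open>0\<close>, negligible.
\<close>
lemma card_F_at_top: "filterlim (\<lambda>N. real (card (F N))) at_top sequentially"
  unfolding filterlim_at_top
proof
  fix Z :: real
  obtain m :: nat where m: "Z \<le> real m"
    using real_arch_simple by blast
  obtain X :: "'k set" where X: "finite X" "card X = Suc m"
    using infinite_arbitrarily_large[OF infinite_field] by blast
  have "\<forall>\<^sub>F N in sequentially. \<forall>x\<in>X.
      1 - 1 / real (Suc m) < real (card (F N \<inter> (\<lambda>y. x + y) ` F N)) / real (card (F N))"
    using X(1) translation_invariant
    by (auto simp: almost_invariant_def eventually_ball_finite_distrib intro!: order_tendstoD(1))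
  then show "\<forall>\<^sub>F N in sequentially. Z \<le> real (card (F N))"
  proof eventually_elim
    case (elim N)
    have "m < card (F N)"
    proof (rule ccontr)
      assume "\<not> m < card (F N)"
      then have le: "real (card (F N)) \<le> real m"
        by simp
      obtain y where y: "y \<in> F N"
        using F_nonempty by blast
      have "F N \<subseteq> (\<lambda>y. x + y) ` F N" if "x \<in> X" for x
      proof (rule ccontr)
        assume "\<not> F N \<subseteq> (\<lambda>y. x + y) ` F N"
        then have "card (F N \<inter> (\<lambda>y. x + y) ` F N) < card (F N)"
          by (intro psubset_card_mono) auto
        then have "real (card (F N \<inter> (\<lambda>y. x + y) ` F N)) \<le> real (card (F N)) - 1"
          by linarith
        moreover have "real (card (F N)) - real (card (F N)) / real (Suc m) < real (card (F N \<inter> (\<lambda>y. x + y) ` F N))"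
          using bspec[OF elim that] card_F_pos[of N] by (simp add: field_simps)
        moreover have "real (card (F N)) / real (Suc m) \<le> 1"
          using le by simp
        ultimately show False
          by linarith
      qed
      then have "(\<lambda>x. y - x) ` X \<subseteq> F N"
        using y by fastforce
      then have "card ((\<lambda>x. y - x) ` X) \<le> card (F N)"
        by (intro card_mono) auto
      also have "card ((\<lambda>x. y - x) ` X) = card X"
        by (intro card_image inj_onI) auto
      finally show False
        using le X by simp
    qed
    then show ?case
      using m by simp
  qed
qed

lemma inverse_card_F: "(\<lambda>N. 1 / real (card (F N))) \<longlonglongrightarrow> 0"
  using tendsto_inverse_0_at_top[OF card_F_at_top] by (simp add: inverse_eq_divide)

text \<open>
  Induction on the degree. If \<open>q\<close> is linear with leading coefficient \<open>c\<close>, then translating \<open>g\<close> by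
  \<open>v\<close> shifts the averaging variable by \<open>v / c\<close>, and convex combinations of translates of \<open>g\<close> can be
  made arbitrarily small. Otherwise van der Corput's trick leads to the averages for
  \<open>q(b + u) - q(c + u)\<close>, which have a positive smaller degree.
\<close>
lemma avg_A_poly:
  assumes "admissible q" "g \<in> V" "mean_zero g"
  shows "(\<lambda>N. nrm (avg (F N) (\<lambda>u. A (poly q u) g))) \<longlonglongrightarrow> 0"
  using assms(1)
proof (induction "degree q" arbitrary: q rule: less_induct)
  case less
  note q = \<open>admissible q\<close>
  have "0 < degree q"
    using q by (simp add: admissible_def)
  show ?case
  proof (cases "degree q = 1")
    case True
    obtain d r where r: "q = pCons d r"
      by (cases q)
    with True obtain c where "r = [:c:]"
      by (auto split: if_splits elim: degree_eq_zeroE)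
    with r True have cd: "q = [:d, c:]" "c \<noteq> 0"
      by auto
    have "(\<lambda>N. nrm (avg (F N) (\<lambda>u. A (poly q u) g) - avg (F N) (\<lambda>u. A (poly q u) 0))) \<longlonglongrightarrow> 0"
    proof (rule avg_orbit_limit[where Ob = "range (\<lambda>v. A v g)"])
      fix h assume "h \<in> range (\<lambda>v. A v g)"
      then obtain v where v: "h = A v g"
        by blast
      have "A (poly q u) h = A (poly q (v / c + u)) g" for u
        using cd assms(2) by (simp add: v A_add[symmetric] algebra_simps)
      then show "\<exists>\<sigma>. almost_invariant F \<sigma> \<and> (\<forall>u. A (poly q u) h = A (poly q (\<sigma> u)) g)"
        using translation_invariant by blast
    next
      show "\<exists>c \<in> convex hull (range (\<lambda>v. A v g)). nrm (c - 0) < e" if "0 < e" for e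
        using assms(3) that by (simp add: mean_zero_def)
    qed (use assms in \<open>auto simp: nrm_A linear_A\<close>)
    moreover have "avg (F N) (\<lambda>u. A (poly q u) 0) = 0" for N
      by (simp add: avg_def linear_0[OF linear_A])
    ultimately show ?thesis
      by simp
  next
    case False
    show ?thesis
    proof (rule van_der_Corput[where B = UNIV and \<sigma> = "\<lambda>b u. b + u" and C = "nrm g"])
      fix b c :: 'k
      assume "b \<noteq> c"
      let ?r = "pcompose q [:b, 1:] - pcompose q [:c, 1:]"
      have deg: "degree ?r = degree q - 1"
        using q \<open>b \<noteq> c\<close> by (rule degree_translate_difference)
      have "admissible ?r"
        using q False deg by (auto simp: admissible_def)
      then have lim: "(\<lambda>N. nrm (avg (F N) (\<lambda>u. A (poly ?r u) g))) \<longlonglongrightarrow> 0"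
        using deg \<open>0 < degree q\<close> by (intro less) auto
      have eq: "avg (F N) (\<lambda>u. ip (A (poly q (b + u)) g) (A (poly q (c + u)) g))
          = ip (avg (F N) (\<lambda>u. A (poly ?r u) g)) g" for N
        using assms(2) by (simp add: ip_avg_left ip_A_A poly_pcompose)
      show "(\<lambda>N. avg (F N) (\<lambda>u. ip (A (poly q (b + u)) g) (A (poly q (c + u)) g))) \<longlonglongrightarrow> 0"
        unfolding eq
      proof (rule Lim_null_comparison)
        show "\<forall>\<^sub>F N in sequentially. norm (ip (avg (F N) (\<lambda>u. A (poly ?r u) g)) g)
            \<le> nrm (avg (F N) (\<lambda>u. A (poly ?r u) g)) * nrm g"
          using assms(2) by (intro always_eventually allI) (auto intro!: Cauchy_Schwarz)
        show "(\<lambda>N. nrm (avg (F N) (\<lambda>u. A (poly ?r u) g)) * nrm g) \<longlonglongrightarrow> 0"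
          using lim by (rule tendsto_mult_left_zero)
      qed
    qed (use assms infinite_field translation_invariant in \<open>auto simp: nrm_A\<close>)
  qed
qed

lemma avg_at_zero: "(\<lambda>N. avg (F N) (\<lambda>u. if u = 0 then a else 0 :: real)) \<longlonglongrightarrow> 0"
proof (rule Lim_null_comparison)
  show "\<forall>\<^sub>F N in sequentially. norm (avg (F N) (\<lambda>u. if u = 0 then a else 0 :: real)) \<le> 1 / real (card (F N)) * \<bar>a\<bar>"
    by (intro always_eventually allI) (simp add: avg_def)
  show "(\<lambda>N. 1 / real (card (F N)) * \<bar>a\<bar>) \<longlonglongrightarrow> 0"
    using inverse_card_F by (rule tendsto_mult_left_zero)
qed

text \<open>
  Van der Corput's trick with multiplicative shifts \<open>u \<mapsto> b u\<close>. The commutation rule turns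
  \<open>D (b u) (A (- p(b u)) f)\<close> into \<open>D u (A (- b p(b u)) (D b f))\<close>, after which \<open>D u\<close> can be dropped
  from inner products.
\<close>
lemma avg_D_A_poly:
  assumes p: "admissible p" and f: "f \<in> V" "mean_zero f"
  shows "(\<lambda>N. nrm (avg (F N) (\<lambda>u. D u (A (- poly p u) f)))) \<longlonglongrightarrow> 0"
proof -
  have d: "0 < degree p"
    using p by (simp add: admissible_def)
  obtain B :: "'k set" where B: "infinite B" "0 \<notin> B" "inj_on (\<lambda>b. b ^ Suc (degree p)) B"
    by (rule infinite_power_inj_on[OF infinite_field zero_less_Suc])
  show ?thesis
  proof (rule van_der_Corput[where B = B and \<sigma> = "\<lambda>b u. b * u" and C = "nrm f"])
    fix b c
    assume bc: "b \<in> B" "c \<in> B" "b \<noteq> c"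
    then have nz: "b \<noteq> 0" "c \<noteq> 0"
      using B(2) by auto
    have pow: "b ^ Suc (degree p) \<noteq> c ^ Suc (degree p)"
      using inj_onD[OF B(3)] bc by blast
    let ?r = "smult c (pcompose p [:0, c:]) - smult b (pcompose p [:0, b:])"
    have deg: "degree ?r = degree p"
      using d pow by (rule degree_dilate_difference)
    define t where "t u = ip (A (poly ?r u) (D b f)) (D c f)" for u
    have "admissible ?r"
      using p deg by (simp add: admissible_def)
    then have lim: "(\<lambda>N. nrm (avg (F N) (\<lambda>u. A (poly ?r u) (D b f)))) \<longlonglongrightarrow> 0"
      using f nz by (intro avg_A_poly mean_zero_D) auto
    have t: "(\<lambda>N. avg (F N) t) \<longlonglongrightarrow> 0"
    proof (rule Lim_null_comparison)
      have eq: "avg (F N) t = ip (avg (F N) (\<lambda>u. A (poly ?r u) (D b f))) (D c f)" for N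
        unfolding t_def[abs_def] using f by (subst ip_avg_left) auto
      show "\<forall>\<^sub>F N in sequentially. norm (avg (F N) t)
          \<le> nrm (avg (F N) (\<lambda>u. A (poly ?r u) (D b f))) * nrm (D c f)"
        unfolding eq real_norm_def using f by (intro always_eventually allI Cauchy_Schwarz) auto
      show "(\<lambda>N. nrm (avg (F N) (\<lambda>u. A (poly ?r u) (D b f))) * nrm (D c f)) \<longlonglongrightarrow> 0"
        using lim by (rule tendsto_mult_left_zero)
    qed
    \<comment> \<open>At \<open>u = 0\<close> the left-hand side vanishes because of \<open>D 0 = 0\<close>, whereas \<open>t 0\<close> need not.\<close>
    have "ip (D (b * u) (A (- poly p (b * u)) f)) (D (c * u) (A (- poly p (c * u)) f))
        = t u - (if u = 0 then t 0 else 0)" for u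
    proof (cases "u = 0")
      case False
      have D: "D (x * u) (A (- poly p (x * u)) f) = D u (A (- (x * poly p (x * u))) (D x f))" if "x \<noteq> 0" for x
        using False that f D_mult[of u x] by (simp add: D_A mult.commute[of x u] mult.assoc)
      have "ip (D (b * u) (A (- poly p (b * u)) f)) (D (c * u) (A (- poly p (c * u)) f))
          = ip (A (- (b * poly p (b * u))) (D b f)) (A (- (c * poly p (c * u))) (D c f))"
        unfolding D[OF nz(1)] D[OF nz(2)] using False f by (intro ip_D_D) auto
      also have "\<dots> = t u"
        using f by (simp add: ip_A_A t_def poly_pcompose mult.commute[of u])
      finally show ?thesis
        using False by simp
    qed (simp add: D_zero ip_zero_left)
    then have "avg (F N) (\<lambda>u. ip (D (b * u) (A (- poly p (b * u)) f)) (D (c * u) (A (- poly p (c * u)) f)))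
        = avg (F N) t - avg (F N) (\<lambda>u. if u = 0 then t 0 else 0)" for N
      by (simp add: avg_diff)
    moreover have "(\<lambda>N. avg (F N) t - avg (F N) (\<lambda>u. if u = 0 then t 0 else 0)) \<longlonglongrightarrow> 0 - 0"
      by (intro tendsto_intros t avg_at_zero)
    ultimately show "(\<lambda>N. avg (F N) (\<lambda>u. ip (D (b * u) (A (- poly p (b * u)) f))
        (D (c * u) (A (- poly p (c * u)) f)))) \<longlonglongrightarrow> 0"
      by simp
  next
    show "nrm (D u (A (- poly p u) f)) \<le> nrm f" for u
      using f nrm_D_le[of "A (- poly p u) f" u] by (simp add: nrm_A)
    show "almost_invariant F (\<lambda>u. b * u)" if "b \<in> B" for b
      using that B(2) by (intro dilation_invariant) auto
  qed (use f B in auto)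
qed

text \<open>
  Every convex combination of translates of \<open>f\<close> differs from \<open>a\<close>, up to a null vector, by the same
  combination of translates of \<open>f - a\<close>, since \<open>a\<close> is invariant and the weights sum to one.
\<close>
lemma mean_zero_diff:
  assumes f: "f \<in> V" and a: "a \<in> V" "\<And>v. nrm (A v a - a) = 0"
    and approx: "\<And>e. 0 < e \<Longrightarrow> \<exists>c \<in> convex hull (range (\<lambda>v. A v f)). nrm (c - a) < e"
  shows "mean_zero (f - a)"
proof -
  let ?H = "convex hull (range (\<lambda>v. A v (f - a)))"
  let ?S = "{c \<in> V. \<exists>c'\<in>?H. nrm (c - a - c') = 0}"
  have HV: "x \<in> V" if "x \<in> ?H" for x
    using that f a(1) by (intro convex_hull_in_V[of "range (\<lambda>v. A v (f - a))"]) auto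
  have "range (\<lambda>v. A v f) \<subseteq> ?S"
  proof safe
    fix v
    have eq: "A v f - a - A v (f - a) = A v a - a"
      by (simp add: linear_diff[OF linear_A])
    then show "\<exists>c'\<in>?H. nrm (A v f - a - c') = 0"
      by (intro bexI[of _ "A v (f - a)"] hull_inc rangeI) (simp only: eq a(2))
  qed (use f in auto)
  moreover have "convex ?S"
  proof (intro convexI CollectI conjI)
    fix x y :: 'v and s t :: real
    assume x: "x \<in> ?S" and y: "y \<in> ?S" and st: "0 \<le> s" "0 \<le> t" "s + t = 1"
    obtain x' y' where x': "x' \<in> ?H" "nrm (x - a - x') = 0" and y': "y' \<in> ?H" "nrm (y - a - y') = 0"
      using x y by blast
    have "s *\<^sub>R a + t *\<^sub>R a = a"
      using st by (metis scaleR_add_left scaleR_one)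
    then have "(s *\<^sub>R x + t *\<^sub>R y) - a - (s *\<^sub>R x' + t *\<^sub>R y')
        = (s *\<^sub>R x + t *\<^sub>R y) - (s *\<^sub>R a + t *\<^sub>R a) - (s *\<^sub>R x' + t *\<^sub>R y')"
      by (simp only:)
    also have "\<dots> = s *\<^sub>R (x - a - x') + t *\<^sub>R (y - a - y')"
      by (simp only: scaleR_diff_right add_diff_add)
    finally have "nrm ((s *\<^sub>R x + t *\<^sub>R y) - a - (s *\<^sub>R x' + t *\<^sub>R y')) = 0"
      using x y a(1) HV[OF x'(1)] HV[OF y'(1)] x'(2) y'(2) by (auto intro!: nrm_null_combination)
    moreover have "s *\<^sub>R x' + t *\<^sub>R y' \<in> ?H"
      using x' y' st by (intro convexD[OF convex_convex_hull]) auto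
    ultimately show "\<exists>c'\<in>?H. nrm ((s *\<^sub>R x + t *\<^sub>R y) - a - c') = 0"
      by blast
  qed auto
  ultimately have hull: "convex hull (range (\<lambda>v. A v f)) \<subseteq> ?S"
    by (rule hull_minimal)
  show ?thesis
    unfolding mean_zero_def
  proof (intro allI impI)
    fix e :: real
    assume "0 < e"
    then obtain c where c: "c \<in> convex hull (range (\<lambda>v. A v f))" "nrm (c - a) < e"
      using approx by blast
    then obtain c' where c': "c' \<in> ?H" "nrm (c - a - c') = 0" "c \<in> V"
      using hull by blast
    then have "nrm (c - a) = nrm c'"
      using a(1) HV by (intro nrm_null_diff) auto
    then show "\<exists>c\<in>?H. nrm c < e"
      using c(2) c'(1) by auto
  qed
qed

text \<open>
  Translation invariance passes from \<open>a\<close> to the \<open>D b a\<close>, as \<open>A v (D b a) = D b (A (v / b) a)\<close>, and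
  then to convex combinations and limits.
\<close>
lemma A_invariant_limit:
  assumes a: "a \<in> V" "\<And>v. nrm (A v a - a) = 0" and m: "m \<in> V"
    and approx: "\<And>e. 0 < e \<Longrightarrow> \<exists>c \<in> convex hull ((\<lambda>b. D b a) ` (- {0})). nrm (c - m) < e"
  shows "nrm (A v m - m) = 0"
proof -
  let ?S = "{c \<in> V. nrm (A v c - c) = 0}"
  have "D b a \<in> ?S" if "b \<noteq> 0" for b
  proof -
    have "A v (D b a) - D b a = D b (A (v / b) a - a)"
      using that a(1) by (simp add: linear_diff[OF linear_D] D_A)
    then show ?thesis
      using that a by (simp add: nrm_D)
  qed
  moreover have "convex ?S"
  proof (intro convexI CollectI conjI)
    fix x y :: 'v and s t :: real
    assume x: "x \<in> ?S" and y: "y \<in> ?S"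
    have "A v (s *\<^sub>R x + t *\<^sub>R y) - (s *\<^sub>R x + t *\<^sub>R y) = s *\<^sub>R (A v x - x) + t *\<^sub>R (A v y - y)"
      by (simp add: linear_add[OF linear_A] linear_scale[OF linear_A] scaleR_diff_right add_diff_add)
    then show "nrm (A v (s *\<^sub>R x + t *\<^sub>R y) - (s *\<^sub>R x + t *\<^sub>R y)) = 0"
      using x y by (auto intro!: nrm_null_combination)
  qed auto
  ultimately have hull: "convex hull ((\<lambda>b. D b a) ` (- {0})) \<subseteq> ?S"
    by (intro hull_minimal) auto
  have "nrm (A v m - m) \<le> 0 + e" if "0 < e" for e
  proof -
    obtain c where "c \<in> convex hull ((\<lambda>b. D b a) ` (- {0}))" and cm: "nrm (c - m) < e / 2"
      using approx half_gt_zero[OF \<open>0 < e\<close>] by blast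
    then have c: "c \<in> V" "nrm (A v c - c) = 0"
      using hull by auto
    have "nrm (A v m - A v c) = nrm (m - c)"
      using nrm_A[of "m - c" v] c m by (simp add: linear_diff[OF linear_A])
    moreover have "nrm (m - c) = nrm (c - m)"
      using c m by (intro nrm_minus_commute) auto
    moreover have "nrm (A v m - m) \<le> nrm (A v m - A v c) + nrm (A v c - m)"
      using c m by (intro nrm_triangle_diff) auto
    moreover have "nrm (A v c - m) \<le> nrm (A v c - c) + nrm (c - m)"
      using c m by (intro nrm_triangle_diff) auto
    ultimately show ?thesis
      using cm c(2) by linarith
  qed
  then have "nrm (A v m - m) \<le> 0"
    by (rule field_le_epsilon)
  then show ?thesis
    using m nrm_nonneg[of "A v m - m"] by simp
qed

text \<open>
  The abstract form of the result: \<open>m\<close> is the orthogonal projection of \<open>f\<close> to the invariant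
  vectors. The error is estimated along the chain from the averages of \<open>D u (A (- p(u)) f)\<close> to those
  with \<open>a\<close> in place of \<open>f\<close>, to the averages of \<open>D u a\<close>, to those of \<open>D u m\<close>, and to \<open>m\<close>; the last
  step loses only the term at \<open>u = 0\<close>.
\<close>
theorem avg_D_A_poly_converges:
  assumes p: "admissible p" and f: "f \<in> V"
  obtains m where "invariant_vector m" and "\<And>h. invariant_vector h \<Longrightarrow> ip (f - m) h = 0"
    and "(\<lambda>N. nrm (avg (F N) (\<lambda>u. D u (A (- poly p u) f)) - m)) \<longlonglongrightarrow> 0"
proof -
  obtain a where a: "a \<in> V" "\<And>v. nrm (A v a - a) = 0"
    "\<And>e. 0 < e \<Longrightarrow> \<exists>c \<in> convex hull (range (\<lambda>v. A v f)). nrm (c - a) < e"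
    by (rule mean_ergodic[of "range (\<lambda>v. A v f)" "range A"])
      (use f isometry_A in \<open>auto simp: A_add[symmetric]\<close>)
  let ?O = "(\<lambda>b. D b a) ` (- {0})"
  have "1 \<in> - {0 :: 'k}"
    by simp
  then have "?O \<noteq> {}"
    by blast
  then
  obtain m where m: "m \<in> V" "\<And>u. u \<noteq> 0 \<Longrightarrow> nrm (D u m - m) = 0"
    "\<And>e. 0 < e \<Longrightarrow> \<exists>c \<in> convex hull ?O. nrm (c - m) < e"
    by (rule mean_ergodic[of ?O "D ` (- {0})", rotated])
      (use a(1) isometry_D in \<open>auto simp: D_mult[symmetric]\<close>)
  show thesis
  proof
    show "invariant_vector m"
      using m(1,2) A_invariant_limit[OF a(1,2) m(1,3)] by (simp add: invariant_vector_def)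
    show "ip (f - m) h = 0" if "invariant_vector h" for h
    proof -
      have h: "h \<in> V" "\<And>v. nrm (A v h - h) = 0" "\<And>u. u \<noteq> 0 \<Longrightarrow> nrm (D u h - h) = 0"
        using that by (auto simp: invariant_vector_def)
      have orbit: "ip (U x) h = ip x h" if "isometry U" "nrm (U h - h) = 0" "x \<in> V" for U x
      proof -
        have U: "U x \<in> V" "U h \<in> V" "ip (U x) (U h) = ip x h"
          using that h(1) by (auto simp: isometry_def)
        then show ?thesis
          using ip_null_right[of "U x" "U h - h"] h(1) that by (simp add: ip_diff_right)
      qed
      have "ip a h = ip f h"
        by (rule ip_hull_limit[OF _ f a(1) h(1) _ a(3)])
          (use f h(2) isometry_A in \<open>auto intro: orbit\<close>)
      moreover have "ip m h = ip a h"
        by (rule ip_hull_limit[OF _ a(1) m(1) h(1) _ m(3)])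
          (use a(1) h(3) isometry_D in \<open>auto intro: orbit\<close>)
      ultimately show ?thesis
        using f m(1) h(1) by (simp add: ip_diff_left)
    qed
    let ?T = "\<lambda>x N. avg (F N) (\<lambda>u. D u (A (- poly p u) x))"
    let ?M = "\<lambda>x N. avg (F N) (\<lambda>u. D u x)"
    have "mean_zero (f - a)"
      using f a by (rule mean_zero_diff)
    then have 1: "(\<lambda>N. nrm (?T (f - a) N)) \<longlonglongrightarrow> 0"
      using p f a(1) by (intro avg_D_A_poly) auto
    have 2: "nrm (?T a N - ?M a N) \<le> 0" for N
    proof -
      have "?T a N - ?M a N = avg (F N) (\<lambda>u. D u (A (- poly p u) a - a))"
        by (simp add: linear_diff[OF linear_D] avg_diff)
      also have "nrm \<dots> \<le> 0"
        using a(1) nrm_D_le[of "A v a - a" for v] a(2) by (intro nrm_avg_le) (auto intro: order_trans)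
      finally show ?thesis .
    qed
    have 3: "(\<lambda>N. nrm (?M a N - ?M m N)) \<longlonglongrightarrow> 0"
    proof (rule avg_orbit_limit[where Ob = ?O])
      fix h assume "h \<in> ?O"
      then obtain b where b: "b \<noteq> 0" "h = D b a"
        by auto
      have "D u h = D (b * u) a" for u
        using b a(1) D_mult[of u b a] by (cases "u = 0") (simp_all add: D_zero mult.commute)
      then show "\<exists>\<sigma>. almost_invariant F \<sigma> \<and> (\<forall>u. D u h = D (\<sigma> u) a)"
        using dilation_invariant[OF b(1)] by blast
    qed (use a(1) m linear_D nrm_D_le in auto)
    have 4: "nrm (?M m N - m) \<le> avg (F N) (\<lambda>u. if u = 0 then nrm m else 0)" for N
    proof -
      have "?M m N - m = avg (F N) (\<lambda>u. D u m - m)"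
        by (simp add: avg_diff avg_const)
      also have "nrm \<dots> \<le> avg (F N) (\<lambda>u. nrm (D u m - m))"
        using m(1) by (intro nrm_avg) auto
      also have "\<dots> \<le> avg (F N) (\<lambda>u. if u = 0 then nrm m else 0)"
        using m(1,2) by (intro avg_mono) (auto simp: D_zero nrm_uminus)
      finally show ?thesis .
    qed
    have TV: "?T x N \<in> V" "?M x N \<in> V" if "x \<in> V" for x N
      using that by auto
    show "(\<lambda>N. nrm (?T f N - m)) \<longlonglongrightarrow> 0"
    proof (rule null_sequence_le)
      show "0 \<le> nrm (?T f N - m)" for N
        using f m(1) by (intro nrm_nonneg) auto
      show "nrm (?T f N - m) \<le> nrm (?T (f - a) N) + nrm (?M a N - ?M m N)
          + avg (F N) (\<lambda>u. if u = 0 then nrm m else 0)" for N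
      proof -
        have "?T f N - ?T a N = ?T (f - a) N"
          by (simp add: linear_diff[OF linear_D] linear_diff[OF linear_A] avg_diff)
        moreover have "nrm (?T f N - m) \<le> nrm (?T f N - ?T a N) + nrm (?T a N - m)"
          "nrm (?T a N - m) \<le> nrm (?T a N - ?M a N) + nrm (?M a N - m)"
          "nrm (?M a N - m) \<le> nrm (?M a N - ?M m N) + nrm (?M m N - m)"
          using f a(1) m(1) TV by (auto intro!: nrm_triangle_diff)
        ultimately show ?thesis
          using 2[of N] 4[of N] by simp
      qed
      show "(\<lambda>N. nrm (?T (f - a) N) + nrm (?M a N - ?M m N)
          + avg (F N) (\<lambda>u. if u = 0 then nrm m else 0)) \<longlonglongrightarrow> 0"
        by (intro tendsto_add_zero 1 3 avg_at_zero)
    qed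
  qed
qed

end

section \<open>Square-integrable functions\<close>

text \<open>With pointwise operations, the spaces of functions below become subspaces in the sense of
  \<^const>\<open>subspace\<close>.\<close>
instantiation "fun" :: (type, real_vector) real_vector
begin

definition scaleR_fun :: "real \<Rightarrow> ('a \<Rightarrow> 'b) \<Rightarrow> 'a \<Rightarrow> 'b" where
  "scaleR_fun r f = (\<lambda>x. r *\<^sub>R f x)"

instance
  by standard (simp_all add: scaleR_fun_def fun_eq_iff scaleR_add_right scaleR_add_left)

end

lemma scaleR_fun_apply: "(r *\<^sub>R f) x = r *\<^sub>R f x"
  by (simp add: scaleR_fun_def)

lemma avg_apply: "avg S \<phi> x = avg S (\<lambda>u. \<phi> u x)"
proof -
  have "(\<Sum>u\<in>S. \<phi> u) x = (\<Sum>u\<in>S. \<phi> u x)"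
    by (induction S rule: infinite_finite_induct) auto
  then show ?thesis
    by (simp add: avg_def scaleR_fun_apply)
qed

lemma L2_borel [measurable_dest]: "f \<in> L2 M \<Longrightarrow> f \<in> borel_measurable M"
  by (simp add: L2_def)

lemma L2_integrable: "f \<in> L2 M \<Longrightarrow> integrable M (\<lambda>x. (cmod (f x))\<^sup>2)"
  by (simp add: L2_def)

lemma L2_add:
  assumes "f \<in> L2 M" "g \<in> L2 M"
  shows "(\<lambda>x. f x + g x) \<in> L2 M"
proof -
  note [measurable] = L2_borel[OF assms(1)] L2_borel[OF assms(2)]
  have "integrable M (\<lambda>x. (cmod (f x + g x))\<^sup>2)"
  proof (rule Bochner_Integration.integrable_bound)
    show "integrable M (\<lambda>x. 2 * (cmod (f x))\<^sup>2 + 2 * (cmod (g x))\<^sup>2)"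
      using assms by (intro Bochner_Integration.integrable_add integrable_mult_right L2_integrable) auto
    have "(cmod (a + b))\<^sup>2 \<le> 2 * (cmod a)\<^sup>2 + 2 * (cmod b)\<^sup>2" for a b
    proof -
      have "(cmod (a + b))\<^sup>2 \<le> (cmod a + cmod b)\<^sup>2"
        by (intro power_mono norm_triangle_ineq) auto
      also have "\<dots> \<le> 2 * (cmod a)\<^sup>2 + 2 * (cmod b)\<^sup>2"
        using sum_squares_bound[of "cmod a" "cmod b"] by (simp add: power2_eq_square algebra_simps)
      finally show ?thesis .
    qed
    then show "AE x in M. norm ((cmod (f x + g x))\<^sup>2) \<le> norm (2 * (cmod (f x))\<^sup>2 + 2 * (cmod (g x))\<^sup>2)"
      by (simp add: abs_of_nonneg)
  qed simp
  then show ?thesis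
    by (simp add: L2_def)
qed

lemma L2_cmult:
  assumes "f \<in> L2 M"
  shows "(\<lambda>x. c * f x) \<in> L2 M"
  using assms by (auto simp: L2_def norm_mult power_mult_distrib intro!: borel_measurable_times)

lemma L2_diff: "f \<in> L2 M \<Longrightarrow> g \<in> L2 M \<Longrightarrow> (\<lambda>x. f x - g x) \<in> L2 M"
  using L2_add[of f M "\<lambda>x. - 1 * g x"] L2_cmult[of g M "- 1"] by simp

lemma L2_integrable_mult:
  assumes "f \<in> L2 M" "g \<in> L2 M"
  shows "integrable M (\<lambda>x. f x * cnj (g x))"
proof -
  note [measurable] = L2_borel[OF assms(1)] L2_borel[OF assms(2)]
  show ?thesis
  proof (rule Bochner_Integration.integrable_bound)
    show "integrable M (\<lambda>x. (cmod (f x))\<^sup>2 + (cmod (g x))\<^sup>2)"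
      using assms by (intro Bochner_Integration.integrable_add L2_integrable)
    have "cmod (a * cnj b) \<le> (cmod a)\<^sup>2 + (cmod b)\<^sup>2" for a b
    proof -
      have "0 \<le> cmod a * cmod b"
        by simp
      then show ?thesis
        unfolding norm_mult complex_mod_cnj using sum_squares_bound[of "cmod a" "cmod b"] by linarith
    qed
    then show "AE x in M. norm (f x * cnj (g x)) \<le> norm ((cmod (f x))\<^sup>2 + (cmod (g x))\<^sup>2)"
      by (simp add: abs_of_nonneg)
    have cnj: "cnj \<in> borel_measurable borel"
      by (intro borel_measurable_continuous_onI continuous_intros)
    show "(\<lambda>x. f x * cnj (g x)) \<in> borel_measurable M"
      using measurable_compose[OF L2_borel[OF assms(2)] cnj] by simp
  qed
qed

lemma L2_inner_self: "L2_inner M f f = complex_of_real (LINT x|M. (cmod (f x))\<^sup>2)"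
  by (simp add: L2_inner_def flip: complex_norm_square integral_complex_of_real)

lemma L2_norm_zero_AE:
  assumes "f \<in> L2 M" "L2_norm M f = 0"
  shows "AE x in M. f x = 0"
proof -
  have "(LINT x|M. (cmod (f x))\<^sup>2) = 0"
    using assms by (simp add: L2_norm_def)
  then have "AE x in M. (cmod (f x))\<^sup>2 = 0"
    using integral_nonneg_eq_0_iff_AE[OF L2_integrable[OF assms(1)]] by simp
  then show ?thesis
    by simp
qed

lemma L2_norm_cong_AE:
  assumes [measurable]: "f \<in> borel_measurable M" "g \<in> borel_measurable M"
    and "AE x in M. f x = g x"
  shows "L2_norm M f = L2_norm M g"
proof -
  have "(LINT x|M. (cmod (f x))\<^sup>2) = (LINT x|M. (cmod (g x))\<^sup>2)"
    using assms(3) by (intro integral_cong_AE) auto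
  then show ?thesis
    by (simp add: L2_norm_def)
qed

lemma nn_integral_L2:
  assumes "f \<in> L2 M"
  shows "(\<integral>\<^sup>+x. ennreal ((cmod (f x))\<^sup>2) \<partial>M) = ennreal ((L2_norm M f)\<^sup>2)"
  using nn_integral_eq_integral[OF L2_integrable[OF assms]] by (simp add: L2_norm_def)

text \<open>
  Along a subsequence \<open>r\<close> the successive differences \<open>h k\<close> have norm below \<open>(1 / 2) ^ k\<close>. On
  a probability space their integrals are then at most \<open>(1 / 2) ^ k\<close> as well, so the series of their
  absolute values is integrable and the subsequence converges almost everywhere. Fatou's lemma shows
  that its pointwise limit is a limit in the mean of the whole sequence.
\<close>
lemma (in prob_space) L2_Riesz_Fischer:
  assumes X: "\<And>n. X n \<in> L2 M"
    and Cauchy: "\<And>e. 0 < e \<Longrightarrow> \<exists>n0. \<forall>m\<ge>n0. \<forall>n\<ge>n0. L2_norm M (\<lambda>x. X m x - X n x) < e"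
  shows "\<exists>l\<in>L2 M. (\<lambda>n::nat. L2_norm M (\<lambda>x. X n x - l x)) \<longlonglongrightarrow> 0"
proof -
  note [measurable] = L2_borel[OF X]
  have "\<exists>n0. \<forall>m\<ge>n0. \<forall>n\<ge>n0. L2_norm M (\<lambda>x. X m x - X n x) < (1 / 2) ^ k" for k :: nat
    by (rule Cauchy) simp
  then obtain n0 where n0: "\<And>k m n. n0 k \<le> m \<Longrightarrow> n0 k \<le> n \<Longrightarrow> L2_norm M (\<lambda>x. X m x - X n x) < (1 / 2) ^ k"
    by metis
  \<comment> \<open>Summation makes the thresholds monotone.\<close>
  define r where "r k = (\<Sum>i\<le>k. n0 i)" for k
  have r_mono: "r k \<le> r j" if "k \<le> j" for k j
    using that unfolding r_def by (intro sum_mono2) auto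
  have n0_le: "n0 k \<le> r k" for k
    unfolding r_def by (rule member_le_sum) auto
  have r: "L2_norm M (\<lambda>x. X m x - X n x) < (1 / 2) ^ k" if "r k \<le> m" "r k \<le> n" for k m n
    using that n0_le[of k] by (intro n0) auto
  define h where "h k x = X (r (Suc k)) x - X (r k) x" for k x
  have h_L2: "h k \<in> L2 M" for k
    unfolding h_def[abs_def] using X by (intro L2_diff)
  note [measurable] = L2_borel[OF h_L2]
  have h_small: "(\<integral>\<^sup>+x. ennreal (cmod (h k x)) \<partial>M) \<le> ennreal ((1 / 2) ^ k)" for k
  proof -
    let ?t = "(1 / 2) ^ k :: real"
    \<comment> \<open>The inequality of arithmetic and geometric means, balanced for \<open>cmod (h k x)\<close> of size \<open>?t\<close>.\<close>
    have "(\<integral>\<^sup>+x. ennreal (cmod (h k x)) \<partial>M) \<le> (\<integral>\<^sup>+x. ennreal (?t / 2 + (cmod (h k x))\<^sup>2 / (2 * ?t)) \<partial>M)"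
    proof (intro nn_integral_mono ennreal_leI)
      fix x
      have "2 * ?t * cmod (h k x) \<le> ?t\<^sup>2 + (cmod (h k x))\<^sup>2"
        by (rule sum_squares_bound)
      then show "cmod (h k x) \<le> ?t / 2 + (cmod (h k x))\<^sup>2 / (2 * ?t)"
        by (simp add: field_simps power2_eq_square)
    qed
    also have "\<dots> = ennreal (LINT x|M. ?t / 2 + (cmod (h k x))\<^sup>2 / (2 * ?t))"
      using L2_integrable[OF h_L2] by (intro nn_integral_eq_integral) auto
    also have "(LINT x|M. ?t / 2 + (cmod (h k x))\<^sup>2 / (2 * ?t)) = ?t / 2 + (L2_norm M (h k))\<^sup>2 / (2 * ?t)"
      using L2_integrable[OF h_L2, of k] by (simp add: L2_norm_def prob_space)
    also have "\<dots> \<le> ?t / 2 + ?t\<^sup>2 / (2 * ?t)"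
    proof -
      have "L2_norm M (h k) \<le> ?t"
        using r[of k "r (Suc k)" "r k"] r_mono[of k "Suc k"] by (simp add: h_def[abs_def])
      then have "(L2_norm M (h k))\<^sup>2 \<le> ?t\<^sup>2"
        by (intro power_mono) (auto simp: L2_norm_def)
      then show ?thesis
        by (intro add_left_mono divide_right_mono) auto
    qed
    also have "\<dots> = ?t"
      by (simp add: power2_eq_square)
    finally show ?thesis
      by (simp add: ennreal_leI)
  qed
  have "(\<integral>\<^sup>+x. (\<Sum>k. ennreal (cmod (h k x))) \<partial>M) = (\<Sum>k. \<integral>\<^sup>+x. ennreal (cmod (h k x)) \<partial>M)"
    by (intro nn_integral_suminf) simp
  also have "\<dots> \<le> (\<Sum>k. ennreal ((1 / 2) ^ k))"
    using h_small by (intro suminf_le) auto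
  also have "\<dots> = ennreal (\<Sum>k. (1 / 2) ^ k)"
    by (intro suminf_ennreal2) (auto intro: summable_geometric)
  finally have "(\<integral>\<^sup>+x. (\<Sum>k. ennreal (cmod (h k x))) \<partial>M) \<noteq> \<infinity>"
    by (auto simp: top_unique)
  then have "AE x in M. (\<Sum>k. ennreal (cmod (h k x))) \<noteq> \<infinity>"
    by (intro nn_integral_PInf_AE) auto
  then have conv: "AE x in M. convergent (\<lambda>k. X (r k) x)"
  proof eventually_elim
    case (elim x)
    then have "summable (\<lambda>k. cmod (h k x))"
      by (intro summable_suminf_not_top) auto
    then have "summable (\<lambda>k. h k x)"
      by (rule summable_norm_cancel)
    then have "convergent (\<lambda>n. \<Sum>k<n. h k x)"
      by (simp add: summable_iff_convergent)
    then have "convergent (\<lambda>n. X (r n) x - X (r 0) x)"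
      by (simp add: h_def sum_lessThan_telescope[of "\<lambda>k. X (r k) x"])
    then show ?case
      by (simp add: convergent_diff_const_right_iff)
  qed
  define l where "l x = lim (\<lambda>k. X (r k) x)" for x
  have [measurable]: "l \<in> borel_measurable M"
    unfolding l_def[abs_def] by measurable
  have dist: "(\<integral>\<^sup>+x. ennreal ((cmod (X n x - l x))\<^sup>2) \<partial>M) \<le> ennreal (((1 / 2) ^ k)\<^sup>2)" if "r k \<le> n" for n k
  proof -
    let ?u = "\<lambda>j x. ennreal ((cmod (X n x - X (r j) x))\<^sup>2)"
    have "AE x in M. ennreal ((cmod (X n x - l x))\<^sup>2) = liminf (\<lambda>j. ?u j x)"
      using conv
    proof eventually_elim
      case (elim x)
      then have "(\<lambda>k. X (r k) x) \<longlonglongrightarrow> l x"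
        by (simp add: l_def convergent_LIMSEQ_iff)
      then have "(\<lambda>j. ?u j x) \<longlonglongrightarrow> ennreal ((cmod (X n x - l x))\<^sup>2)"
        by (intro tendsto_intros)
      then show ?case
        by (intro lim_imp_Liminf[symmetric]) auto
    qed
    then have "(\<integral>\<^sup>+x. ennreal ((cmod (X n x - l x))\<^sup>2) \<partial>M) = (\<integral>\<^sup>+x. liminf (\<lambda>j. ?u j x) \<partial>M)"
      by (rule nn_integral_cong_AE)
    also have "\<dots> \<le> liminf (\<lambda>j. \<integral>\<^sup>+x. ?u j x \<partial>M)"
      by (intro nn_integral_liminf) simp
    also have "\<dots> \<le> limsup (\<lambda>j. \<integral>\<^sup>+x. ?u j x \<partial>M)"
      by (intro Liminf_le_Limsup) simp
    also have "\<dots> \<le> ennreal (((1 / 2) ^ k)\<^sup>2)"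
    proof (rule Limsup_bounded)
      show "\<forall>\<^sub>F j in sequentially. (\<integral>\<^sup>+x. ?u j x \<partial>M) \<le> ennreal (((1 / 2) ^ k)\<^sup>2)"
        using eventually_ge_at_top[of k]
      proof eventually_elim
        case (elim j)
        have "L2_norm M (\<lambda>x. X n x - X (r j) x) < (1 / 2) ^ k"
          using that r_mono[OF elim] by (rule r)
        then have "(L2_norm M (\<lambda>x. X n x - X (r j) x))\<^sup>2 \<le> ((1 / 2) ^ k)\<^sup>2"
          by (intro power_mono) (auto simp: L2_norm_def)
        then show ?case
          using nn_integral_L2[OF L2_diff[OF X X], of n "r j"] by (simp add: ennreal_leI)
      qed
    qed
    finally show ?thesis .
  qed
  have diff_L2: "(\<lambda>x. X n x - l x) \<in> L2 M" if "r 0 \<le> n" for n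
  proof -
    have "integrable M (\<lambda>x. (cmod (X n x - l x))\<^sup>2)"
      using dist[OF that] by (intro integrableI_bounded) (auto simp: less_top[symmetric] top_unique)
    then show ?thesis
      by (simp add: L2_def)
  qed
  have "l \<in> L2 M"
    using L2_diff[OF X[of "r 0"] diff_L2[of "r 0"]] by simp
  moreover have "(\<lambda>n. L2_norm M (\<lambda>x. X n x - l x)) \<longlonglongrightarrow> 0"
  proof (rule LIMSEQ_I)
    fix e :: real
    assume "0 < e"
    then obtain k :: nat where k: "(1 / 2) ^ k < e"
      using real_arch_pow_inv[of e "1 / 2"] by auto
    have "norm (L2_norm M (\<lambda>x. X n x - l x) - 0) < e" if "r k \<le> n" for n
    proof -
      have "r 0 \<le> n"
        using that r_mono[of 0 k] by simp
      have "ennreal ((L2_norm M (\<lambda>x. X n x - l x))\<^sup>2) \<le> ennreal (((1 / 2) ^ k)\<^sup>2)"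
        using dist[OF that] nn_integral_L2[OF diff_L2[OF \<open>r 0 \<le> n\<close>]] by simp
      then have "(L2_norm M (\<lambda>x. X n x - l x))\<^sup>2 \<le> ((1 / 2) ^ k)\<^sup>2"
        by (subst (asm) ennreal_le_iff) auto
      then have "L2_norm M (\<lambda>x. X n x - l x) \<le> (1 / 2) ^ k"
        by (rule power2_le_imp_le) simp
      then show ?thesis
        using k by (simp add: L2_norm_def)
    qed
    then show "\<exists>no. \<forall>n\<ge>no. norm (L2_norm M (\<lambda>x. X n x - l x) - 0) < e"
      by blast
  qed
  ultimately show ?thesis
    by blast
qed

text \<open>
  The identities of a group representation hold only at points of \<^term>\<open>space M\<close>. Prescribing the
  value \<open>0\<close> elsewhere turns them into equations between functions.
\<close>
definition L2_space :: "'a measure \<Rightarrow> ('a \<Rightarrow> complex) set" where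
  "L2_space M = {f \<in> L2 M. \<forall>x. x \<notin> space M \<longrightarrow> f x = 0}"

text \<open>
  The real part suffices for norms and for convexity arguments; orthogonality for the complex inner
  product is recovered at the end by testing with \<open>h\<close> and with \<open>\<i> * h\<close>.
\<close>
definition re_inner :: "'a measure \<Rightarrow> ('a \<Rightarrow> complex) \<Rightarrow> ('a \<Rightarrow> complex) \<Rightarrow> real" where
  "re_inner M f g = Re (L2_inner M f g)"

definition on_space :: "'a measure \<Rightarrow> ('a \<Rightarrow> complex) \<Rightarrow> 'a \<Rightarrow> complex" where
  "on_space M f = (\<lambda>x. if x \<in> space M then f x else 0)"

lemma L2_cong:
  assumes "\<And>x. x \<in> space M \<Longrightarrow> f x = g x"
  shows "f \<in> L2 M \<longleftrightarrow> g \<in> L2 M"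
proof -
  have "f \<in> borel_measurable M \<longleftrightarrow> g \<in> borel_measurable M"
    using assms by (rule measurable_cong)
  moreover have "integrable M (\<lambda>x. (cmod (f x))\<^sup>2) \<longleftrightarrow> integrable M (\<lambda>x. (cmod (g x))\<^sup>2)"
    using assms by (intro Bochner_Integration.integrable_cong) auto
  ultimately show ?thesis
    by (simp add: L2_def)
qed

lemma L2_inner_cong:
  assumes "\<And>x. x \<in> space M \<Longrightarrow> f x = f' x" "\<And>x. x \<in> space M \<Longrightarrow> g x = g' x"
  shows "L2_inner M f g = L2_inner M f' g'"
  unfolding L2_inner_def using assms by (intro Bochner_Integration.integral_cong) auto

lemma on_space_in_L2_space: "f \<in> L2 M \<Longrightarrow> on_space M f \<in> L2_space M"
  using L2_cong[of M "on_space M f" f] by (simp add: L2_space_def on_space_def)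

lemma L2_inner_diff_left:
  assumes "f \<in> L2 M" "g \<in> L2 M" "h \<in> L2 M"
  shows "L2_inner M (\<lambda>x. f x - g x) h = L2_inner M f h - L2_inner M g h"
  using Bochner_Integration.integral_diff[OF L2_integrable_mult[OF assms(1,3)] L2_integrable_mult[OF assms(2,3)]]
  by (simp add: L2_inner_def left_diff_distrib)

lemma L2_inner_add_left:
  assumes "f \<in> L2 M" "g \<in> L2 M" "h \<in> L2 M"
  shows "L2_inner M (\<lambda>x. f x + g x) h = L2_inner M f h + L2_inner M g h"
  using Bochner_Integration.integral_add[OF L2_integrable_mult[OF assms(1,3)] L2_integrable_mult[OF assms(2,3)]]
  by (simp add: L2_inner_def distrib_right)

context prob_space
begin

lemma semi_hilbert_L2: "semi_hilbert (L2_space M) (re_inner M)"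
proof -
  interpret semi_inner_space "L2_space M" "re_inner M"
  proof
    show "subspace (L2_space M)"
      by (auto simp: subspace_def L2_space_def scaleR_fun_def plus_fun_def zero_fun_def scaleR_conv_of_real
          intro: L2_add L2_cmult) (simp add: L2_def)
    show "re_inner M x y = re_inner M y x" for x y
      using Bochner_Integration.integral_cnj[of M "\<lambda>t. x t * cnj (y t)"]
      by (simp add: re_inner_def L2_inner_def mult.commute)
    show "re_inner M (x + y) z = re_inner M x z + re_inner M y z"
      if "x \<in> L2_space M" "y \<in> L2_space M" "z \<in> L2_space M" for x y z
      using L2_inner_add_left[of x M y z] that by (simp add: re_inner_def L2_space_def plus_fun_def)
    show "re_inner M (r *\<^sub>R x) y = r * re_inner M x y" for r x y
      by (simp add: re_inner_def L2_inner_def scaleR_fun_def)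
    show "0 \<le> re_inner M x x" for x
      by (simp add: re_inner_def L2_inner_self)
  qed
  have nrm: "nrm x = L2_norm M x" for x
    by (simp add: nrm_def re_inner_def L2_inner_self L2_norm_def)
  show ?thesis
  proof
    fix X :: "nat \<Rightarrow> 'a \<Rightarrow> complex"
    assume X: "\<And>n. X n \<in> L2_space M"
      and Cauchy: "\<And>e. 0 < e \<Longrightarrow> \<exists>n0. \<forall>m\<ge>n0. \<forall>n\<ge>n0. nrm (X m - X n) < e"
    have XL: "X n \<in> L2 M" for n
      using X by (simp add: L2_space_def)
    obtain l where l: "l \<in> L2 M" "(\<lambda>n. L2_norm M (\<lambda>x. X n x - l x)) \<longlonglongrightarrow> 0"
      using L2_Riesz_Fischer[of X, OF XL] Cauchy by (auto simp: nrm fun_diff_def)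
    have "L2_norm M (\<lambda>x. X n x - l x) = nrm (X n - on_space M l)" for n
      unfolding nrm fun_diff_def
      using XL[of n] l(1) on_space_in_L2_space[OF l(1)]
      by (intro L2_norm_cong_AE L2_borel L2_diff AE_I2) (auto simp: L2_space_def on_space_def)
    then show "\<exists>l\<in>L2_space M. (\<lambda>n. nrm (X n - l)) \<longlonglongrightarrow> 0"
      using l(2) on_space_in_L2_space[OF l(1)] by auto
  qed
qed

end

section \<open>The Koopman representation of the affine group\<close>

locale affine_system = prob_space M
  for M :: "'a measure" and T :: "('k::field \<Rightarrow> 'k) \<Rightarrow> 'a \<Rightarrow> 'a" +
  assumes action: "measure_preserving_affine_action M T"
begin

sublocale semi_hilbert "L2_space M" "re_inner M"
  by (rule semi_hilbert_L2)

sublocale group_action affine_group "space M" T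
  using action by (simp add: measure_preserving_affine_action_def)

lemma nrm_eq_L2_norm: "nrm f = L2_norm M f"
  by (simp add: nrm_def re_inner_def L2_inner_self L2_norm_def)

lemma T_measurable: "g \<in> carrier affine_group \<Longrightarrow> T g \<in> measurable M M"
  using action by (simp add: measure_preserving_affine_action_def)

lemma T_space: "g \<in> carrier affine_group \<Longrightarrow> x \<in> space M \<Longrightarrow> T g x \<in> space M"
  using T_measurable by (rule measurable_space)

lemma T_distr: "g \<in> carrier affine_group \<Longrightarrow> distr M M (T g) = M"
  using action T_measurable[of g]
  by (intro measure_eqI) (auto simp: measure_preserving_affine_action_def emeasure_distr)

lemma T_comp:
  assumes "g \<in> carrier affine_group" "h \<in> carrier affine_group" "x \<in> space M"
  shows "T (g \<circ> h) x = T g (T h x)"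
  using composition_rule[OF assms(3,1,2)] by (simp add: affine_group_def)

lemma T_id: "x \<in> space M \<Longrightarrow> T id x = x"
  using fun_cong[OF id_eq_one, of x] by (simp add: affine_group_def)

lemma affine_comp: "g \<in> carrier affine_group \<Longrightarrow> h \<in> carrier affine_group \<Longrightarrow> g \<circ> h \<in> carrier (affine_group :: ('k \<Rightarrow> 'k) monoid)"
  using group.is_monoid[OF group_affine_group] monoid.m_closed by (fastforce simp: affine_group_def)

text \<open>
  The Koopman operator of \<open>g\<close> without inverse images: it is the pullback along the inverse of \<open>g\<close>,
  by \<open>koopman_eq_pullback\<close>.
\<close>
definition pullback :: "('k \<Rightarrow> 'k) \<Rightarrow> ('a \<Rightarrow> complex) \<Rightarrow> 'a \<Rightarrow> complex" where
  "pullback h f = (\<lambda>x. if x \<in> space M then f (T h x) else 0)"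

lemma koopman_eq_pullback:
  assumes g: "g \<in> carrier affine_group" and h: "h \<in> carrier affine_group" and gh: "g \<circ> h = id"
    and x: "x \<in> space M"
  shows "koopman M T g f x = pullback h f x"
proof -
  have "T g (T h x) = x"
    using T_comp[OF g h x] gh T_id[OF x] by simp
  then have "inv_into (space M) (T g) x = T h x"
    by (intro inv_into_f_eq inj_prop[OF g] T_space[OF h x])
  then show ?thesis
    using x by (simp add: koopman_def pullback_def)
qed

lemma pullback_comp:
  assumes "g \<in> carrier affine_group" "h \<in> carrier affine_group"
  shows "pullback g (pullback h f) = pullback (h \<circ> g) f"
  using assms by (auto simp: pullback_def T_comp T_space)

lemma pullback_id: "f \<in> L2_space M \<Longrightarrow> pullback id f = f"
  by (auto simp: pullback_def T_id L2_space_def)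

lemma linear_pullback: "linear (pullback h)"
  by (intro linearI) (auto simp: pullback_def scaleR_fun_def fun_eq_iff)

lemma pullback_L2:
  assumes h: "h \<in> carrier affine_group" and f: "f \<in> L2 M"
  shows "pullback h f \<in> L2_space M"
proof -
  have "(\<lambda>x. f (T h x)) \<in> borel_measurable M"
    using T_measurable[OF h] L2_borel[OF f] by (rule measurable_compose)
  moreover have "integrable M (\<lambda>x. (cmod (f (T h x)))\<^sup>2)"
    using integrable_distr[OF T_measurable[OF h], of "\<lambda>x. (cmod (f x))\<^sup>2"] L2_integrable[OF f]
    by (simp add: T_distr[OF h])
  ultimately have "(\<lambda>x. f (T h x)) \<in> L2 M"
    by (simp add: L2_def)
  then have "on_space M (\<lambda>x. f (T h x)) \<in> L2_space M"
    by (rule on_space_in_L2_space)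
  then show ?thesis
    by (simp add: on_space_def pullback_def)
qed

lemma isometry_pullback:
  assumes h: "h \<in> carrier affine_group"
  shows "isometry (pullback h)"
  unfolding isometry_def
proof (intro conjI ballI linear_pullback)
  show "pullback h f \<in> L2_space M" if "f \<in> L2_space M" for f
    using that by (intro pullback_L2 h) (simp add: L2_space_def)
  fix f g
  assume fg: "f \<in> L2_space M" "g \<in> L2_space M"
  have "L2_inner M (pullback h f) (pullback h g) = (LINT x|M. f (T h x) * cnj (g (T h x)))"
    unfolding L2_inner_def by (intro Bochner_Integration.integral_cong) (auto simp: pullback_def)
  also have "\<dots> = (LINT x|distr M M (T h). f x * cnj (g x))"
    using fg by (intro integral_distr[symmetric] T_measurable h borel_measurable_integrable L2_integrable_mult)
      (auto simp: L2_space_def)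
  finally show "re_inner M (pullback h f) (pullback h g) = re_inner M f g"
    by (simp add: re_inner_def L2_inner_def T_distr[OF h])
qed

definition shift :: "'k \<Rightarrow> ('a \<Rightarrow> complex) \<Rightarrow> 'a \<Rightarrow> complex" where
  "shift v = pullback (translation (- v))"

definition scale :: "'k \<Rightarrow> ('a \<Rightarrow> complex) \<Rightarrow> 'a \<Rightarrow> complex" where
  "scale u = (if u = 0 then (\<lambda>_. 0) else pullback (dilation (1 / u)))"

lemma koopman_translation: "x \<in> space M \<Longrightarrow> koopman M T (translation v) f x = shift v f x"
  unfolding shift_def
  by (intro koopman_eq_pullback translation_in_affine_group) (auto simp: translation_def)

lemma koopman_dilation: "u \<noteq> 0 \<Longrightarrow> x \<in> space M \<Longrightarrow> koopman M T (dilation u) f x = scale u f x"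
  by (simp add: scale_def) (intro koopman_eq_pullback dilation_in_affine_group; auto simp: dilation_def)

text \<open>Translations and dilations generate the affine group, so they suffice to test invariance.\<close>
lemma koopman_affine:
  assumes "u \<noteq> 0" "x \<in> space M"
  shows "koopman M T (\<lambda>y. u * y + v) f x = shift v (scale u f) x"
proof -
  have "koopman M T (\<lambda>y. u * y + v) f x = pullback (dilation (1 / u) \<circ> translation (- v)) f x"
    using assms
    by (intro koopman_eq_pullback affine_comp dilation_in_affine_group translation_in_affine_group)
      (auto simp: affine_group_def dilation_def translation_def)
  then show ?thesis
    using assms by (simp add: shift_def scale_def pullback_comp dilation_in_affine_group translation_in_affine_group)
qed

sublocale affine_representation "L2_space M" "re_inner M" shift scale
proof
  fix u v w :: 'k and x :: "'a \<Rightarrow> complex"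
  note carrier = dilation_in_affine_group translation_in_affine_group
  show "isometry (shift v)"
    by (simp add: shift_def isometry_pullback carrier)
  show "isometry (scale u)" if "u \<noteq> 0"
    using that by (simp add: scale_def isometry_pullback carrier)
  show "scale 0 x = 0"
    by (simp add: scale_def zero_fun_def)
  show "shift (v + w) x = shift v (shift w x)"
    by (simp add: shift_def pullback_comp carrier) (simp add: translation_def o_def algebra_simps)
  show "scale (u * w) x = scale u (scale w x)" if "u \<noteq> 0" "w \<noteq> 0"
    using that by (simp add: scale_def pullback_comp carrier) (simp add: dilation_def o_def field_simps)
  show "scale u (shift v x) = shift (u * v) (scale u x)" if "u \<noteq> 0"
    using that by (simp add: scale_def shift_def pullback_comp carrier)
      (simp add: dilation_def translation_def o_def field_simps)
  have "translation 0 = (id :: 'k \<Rightarrow> 'k)" "dilation 1 = (id :: 'k \<Rightarrow> 'k)"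
    by (auto simp: translation_def dilation_def)
  then show "shift 0 x = x" "scale 1 x = x" if "x \<in> L2_space M"
    using that by (simp_all add: shift_def scale_def pullback_id)
qed

lemma nrm_zero_iff_AE:
  assumes "f \<in> L2_space M"
  shows "nrm f = 0 \<longleftrightarrow> (AE x in M. f x = 0)"
proof
  show "AE x in M. f x = 0" if "nrm f = 0"
    using assms that by (intro L2_norm_zero_AE) (auto simp: L2_space_def nrm_eq_L2_norm)
  assume "AE x in M. f x = 0"
  then have "L2_norm M f = L2_norm M (\<lambda>_. 0)"
    using assms by (intro L2_norm_cong_AE) (auto simp: L2_space_def L2_def)
  then show "nrm f = 0"
    by (simp add: nrm_eq_L2_norm L2_norm_def)
qed

lemma invariant_vector_on_space:
  assumes h: "h \<in> affine_invariant M T"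
  shows "invariant_vector (on_space M h)"
proof -
  have hL: "h \<in> L2 M" "on_space M h \<in> L2_space M"
    using h by (auto simp: affine_invariant_def on_space_in_L2_space)
  have k: "AE x in M. koopman M T (translation v) h x = h x" for v
    using h translation_in_affine_group unfolding affine_invariant_def by blast
  have "AE x in M. (shift v (on_space M h) - on_space M h) x = 0" for v
    using k[of v] AE_space
  proof eventually_elim
    case (elim x)
    then have "shift v (on_space M h) x = shift v h x"
      by (simp add: shift_def pullback_def on_space_def T_space translation_in_affine_group)
    then show ?case
      using elim by (simp add: koopman_translation on_space_def)
  qed
  then have shift: "nrm (shift v (on_space M h) - on_space M h) = 0" for v
    using hL by (subst nrm_zero_iff_AE) auto
  have k': "AE x in M. koopman M T (dilation u) h x = h x" if "u \<noteq> 0" for u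
    using h dilation_in_affine_group[OF that] unfolding affine_invariant_def by blast
  have "AE x in M. (scale u (on_space M h) - on_space M h) x = 0" if u: "u \<noteq> 0" for u
    using k'[OF u] AE_space
  proof eventually_elim
    case (elim x)
    then have "scale u (on_space M h) x = scale u h x"
      using u by (simp add: scale_def pullback_def on_space_def T_space dilation_in_affine_group)
    then show ?case
      using elim u by (simp add: koopman_dilation on_space_def)
  qed
  then have "nrm (scale u (on_space M h) - on_space M h) = 0" if "u \<noteq> 0" for u
    using hL that by (subst nrm_zero_iff_AE) auto
  with shift hL show ?thesis
    by (simp add: invariant_vector_def)
qed

lemma affine_invariantI:
  assumes "invariant_vector m"
  shows "m \<in> affine_invariant M T"
proof -
  have m: "m \<in> L2_space M" and shift: "\<And>v. nrm (shift v m - m) = 0"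
    and scale: "\<And>u. u \<noteq> 0 \<Longrightarrow> nrm (scale u m - m) = 0"
    using assms by (auto simp: invariant_vector_def)
  have "AE x in M. koopman M T g m x = m x" if g_in: "g \<in> carrier affine_group" for g
  proof -
    obtain u v where g: "g = (\<lambda>y. u * y + v)" "u \<noteq> 0"
      using g_in by (auto simp: affine_group_def)
    have "shift v (scale u m) - shift v m = shift v (scale u m - m)"
      by (simp add: linear_diff[OF linear_A])
    then have "nrm (shift v (scale u m) - m) \<le> nrm (shift v (scale u m - m)) + nrm (shift v m - m)"
      using nrm_triangle_diff[of "shift v (scale u m)" "shift v m" m] m by auto
    also have "\<dots> = 0"
      using m g scale shift by (simp add: nrm_A)
    finally have "nrm (shift v (scale u m) - m) = 0"
      using m nrm_nonneg[of "shift v (scale u m) - m"] by simp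
    then have "AE x in M. (shift v (scale u m) - m) x = 0"
      using m by (subst (asm) nrm_zero_iff_AE) auto
    then show ?thesis
      using AE_space
    proof eventually_elim
      case (elim x)
      then show ?case
        using koopman_affine[OF g(2)] g(1) by simp
    qed
  qed
  then show ?thesis
    using m by (simp add: affine_invariant_def L2_space_def)
qed

lemma affine_invariant_diff:
  assumes "f \<in> affine_invariant M T" "g \<in> affine_invariant M T"
  shows "(\<lambda>x. f x - g x) \<in> affine_invariant M T"
proof -
  have "AE x in M. koopman M T h (\<lambda>x. f x - g x) x = f x - g x" if h: "h \<in> carrier affine_group" for h
  proof -
    have "AE x in M. koopman M T h f x = f x" "AE x in M. koopman M T h g x = g x"
      using assms h by (auto simp: affine_invariant_def)
    then show ?thesis
      by eventually_elim (simp add: koopman_def)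
  qed
  then show ?thesis
    using assms by (auto simp: affine_invariant_def intro: L2_diff)
qed

lemma affine_invariant_cmult:
  assumes "f \<in> affine_invariant M T"
  shows "(\<lambda>x. c * f x) \<in> affine_invariant M T"
  using assms by (auto simp: affine_invariant_def koopman_def intro: L2_cmult)

text \<open>
  The difference of two candidates is invariant and orthogonal to all invariant functions, hence to
  itself.
\<close>
lemma orthogonal_projection_eqI:
  assumes f: "f \<in> L2 M" and m: "m \<in> affine_invariant M T"
    and orth: "\<forall>h\<in>affine_invariant M T. L2_inner M (\<lambda>x. f x - m x) h = 0"
  defines "P \<equiv> orthogonal_projection M (affine_invariant M T) f"
  shows "P \<in> L2 M" and "AE x in M. P x = m x"
proof -
  have P: "P \<in> affine_invariant M T \<and> (\<forall>h\<in>affine_invariant M T. L2_inner M (\<lambda>x. f x - P x) h = 0)"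
    unfolding P_def orthogonal_projection_def
    by (rule someI[of _ m]) (use m orth in auto)
  then show PL: "P \<in> L2 M"
    by (simp add: affine_invariant_def)
  have mL: "m \<in> L2 M"
    using m by (simp add: affine_invariant_def)
  let ?d = "\<lambda>x. P x - m x"
  have d: "?d \<in> affine_invariant M T"
    using P m by (intro affine_invariant_diff) auto
  have dL: "?d \<in> L2 M"
    using PL mL by (rule L2_diff)
  have "L2_inner M ?d ?d = L2_inner M (\<lambda>x. (f x - m x) - (f x - P x)) ?d"
    by simp
  also have "\<dots> = 0"
    using L2_inner_diff_left[OF L2_diff[OF f mL] L2_diff[OF f PL] dL] orth P d by simp
  finally have "L2_norm M ?d = 0"
    by (simp add: L2_inner_self L2_norm_def)
  then show "AE x in M. P x = m x"
    using L2_norm_zero_AE[OF dL] by simp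
qed

end

theorem theorem1p13:
  fixes p :: "'k::field poly"
    and F :: "nat \<Rightarrow> 'k set"
    and M :: "'a measure"
    and T :: "('k \<Rightarrow> 'k) \<Rightarrow> 'a \<Rightarrow> 'a"
    and f :: "'a \<Rightarrow> complex"
  assumes "countable (UNIV :: 'k set)" and "infinite (UNIV :: 'k set)"
    and "degree p > 0" and "admissible p"
    and "double_folner F"
    and "prob_space M"
    and "measure_preserving_affine_action M T"
    and "f \<in> L2 M"
  shows "L2_tendsto M
           (\<lambda>N x. 1 / of_nat (card (F N)) *
              (\<Sum>u \<in> F N - {0}. koopman M T (dilation u) (koopman M T (translation (- poly p u)) f) x))
           (orthogonal_projection M (affine_invariant M T) f)"
proof -
  interpret prob_space M
    by fact
  interpret affine_system M T
    by unfold_locales fact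
  interpret affine_averaging "L2_space M" "re_inner M" shift scale F
    using assms(2,5) by unfold_locales (auto simp: double_folner_def almost_invariant_def inj_def)
  let ?f = "on_space M f"
  have fV: "?f \<in> L2_space M"
    using assms(8) by (rule on_space_in_L2_space)
  obtain m where m: "invariant_vector m" and orth: "\<And>h. invariant_vector h \<Longrightarrow> re_inner M (?f - m) h = 0"
    and lim: "(\<lambda>N. nrm (avg (F N) (\<lambda>u. scale u (shift (- poly p u) ?f)) - m)) \<longlonglongrightarrow> 0"
    using avg_D_A_poly_converges[OF assms(4) fV] by blast
  let ?s = "\<lambda>N x. 1 / of_nat (card (F N)) *
    (\<Sum>u \<in> F N - {0}. koopman M T (dilation u) (koopman M T (translation (- poly p u)) f) x)"
  let ?S = "\<lambda>N. avg (F N) (\<lambda>u. scale u (shift (- poly p u) ?f))"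
  let ?P = "orthogonal_projection M (affine_invariant M T) f"
  have s: "?s N x = ?S N x" if x: "x \<in> space M" for N x
  proof -
    have "koopman M T (dilation u) (koopman M T (translation (- poly p u)) f) x
        = scale u (shift (- poly p u) ?f) x" if "u \<noteq> 0" for u
    proof -
      have "koopman M T (dilation u) (koopman M T (translation (- poly p u)) f) x
          = scale u (koopman M T (translation (- poly p u)) f) x"
        using that x by (rule koopman_dilation)
      also have "\<dots> = scale u (shift (- poly p u) f) x"
        using that x by (simp add: scale_def pullback_def koopman_translation T_space dilation_in_affine_group)
      also have "\<dots> = scale u (shift (- poly p u) ?f) x"
        using that x by (simp add: scale_def shift_def pullback_def on_space_def T_space dilation_in_affine_group translation_in_affine_group)
      finally show ?thesis .
    qed
    then have "(\<Sum>u \<in> F N - {0}. koopman M T (dilation u) (koopman M T (translation (- poly p u)) f) x)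
        = (\<Sum>u \<in> F N - {0}. scale u (shift (- poly p u) ?f) x)"
      by (intro sum.cong) auto
    also have "\<dots> = (\<Sum>u \<in> F N. scale u (shift (- poly p u) ?f) x)"
      by (intro sum.mono_neutral_left) (auto simp: scale_def)
    finally show ?thesis
      by (simp only: avg_apply) (simp add: avg_def scaleR_conv_of_real)
  qed
  have SV: "?S N \<in> L2_space M" for N
    using fV by auto
  have sL: "?s N \<in> L2 M" for N
    using SV[of N] L2_cong[of M "?s N" "?S N"] s by (simp add: L2_space_def)
  have m_inv: "m \<in> affine_invariant M T"
    using m by (rule affine_invariantI)
  have mV: "m \<in> L2_space M"
    using m by (simp add: invariant_vector_def)
  have re_orth: "Re (L2_inner M (\<lambda>x. f x - m x) h) = 0" if h: "h \<in> affine_invariant M T" for h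
  proof -
    have "re_inner M (?f - m) (on_space M h) = 0"
      by (intro orth invariant_vector_on_space h)
    moreover have "L2_inner M (?f - m) (on_space M h) = L2_inner M (\<lambda>x. f x - m x) h"
      by (intro L2_inner_cong) (auto simp: on_space_def)
    ultimately show ?thesis
      by (simp add: re_inner_def)
  qed
  have "\<forall>h\<in>affine_invariant M T. L2_inner M (\<lambda>x. f x - m x) h = 0"
  proof (intro ballI complex_eqI)
    fix h
    assume h: "h \<in> affine_invariant M T"
    \<comment> \<open>The imaginary part is the real part for the invariant function \<open>\<i> * h\<close>.\<close>
    have "L2_inner M (\<lambda>x. f x - m x) (\<lambda>x. \<i> * h x) = - \<i> * L2_inner M (\<lambda>x. f x - m x) h"
      by (simp add: L2_inner_def mult.left_commute flip: integral_mult_right_zero)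
    then show "Im (L2_inner M (\<lambda>x. f x - m x) h) = Im 0"
      using re_orth[OF affine_invariant_cmult[OF h, of \<i>]] by simp
    show "Re (L2_inner M (\<lambda>x. f x - m x) h) = Re 0"
      using re_orth[OF h] by simp
  qed
  note P = orthogonal_projection_eqI[OF assms(8) m_inv this]
  have "L2_norm M (\<lambda>x. ?s N x - ?P x) = nrm (?S N - m)" for N
    unfolding nrm_eq_L2_norm
  proof (rule L2_norm_cong_AE)
    show "AE x in M. ?s N x - ?P x = (?S N - m) x"
      using P(2) AE_space
    proof eventually_elim
      case (elim x)
      then show ?case
        using s[OF elim(2), of N] by simp
    qed
    show "(\<lambda>x. ?s N x - ?P x) \<in> borel_measurable M"
      using sL P(1) by (intro L2_borel L2_diff)
    show "?S N - m \<in> borel_measurable M"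
      using V_closed(3)[OF SV[of N] mV] by (intro L2_borel) (simp add: L2_space_def)
  qed
  then show ?thesis
    using lim sL P(1) by (simp add: L2_tendsto_def)
qed

end
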